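(* There is a function $f:\mathbb{N}\to\mathbb{N}$ such that every clean rectangle overlap graph $G$ satisfies $\chi_3(G)\le f(\omega(G))$, i.e. $\chi_3=O_\omega(1)$.
   Context: Graphs are finite and simple; $\omega$ is the clique number. A $K_k$-free coloring of a graph is a coloring of its vertices (not necessarily proper) such that every color class induces a subgraph containing no clique of size $k$; $\chi_k$ is the minimum number of colors in a $K_k$-free coloring. So $\chi_3$ is the minimum number of colors in a coloring where each color class induces a triangle-free subgraph. Two sets overlap if they intersect and neither contains the other. A rectangle overlap graph is a graph $G$ with a bijection $\mu$ from $V(G)$ to closed axis-parallel rectangles in $\mathbb{R}^2$ such that $uv\in E(G)$ iff $\mu(u),\mu(v)$ overlap; it is clean if $\mu$ can be chosen so that there are no three vertices $x,y,z$ with $\mu(x),\mu(y)$ overlapping and $\mu(z)\subseteq\mu(x)\cap\mu(y)$. *)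

theory Defs
  imports "HOL-Analysis.Analysis" "HOL-Library.Ramsey"
begin

definition simple_graph :: "'a set \<Rightarrow> 'a set set \<Rightarrow> bool" where
  "simple_graph V E \<longleftrightarrow> finite V \<and> E \<subseteq> [V]\<^bsup>2\<^esup>"

definition clique_number :: "'a set \<Rightarrow> 'a set set \<Rightarrow> nat" where
  "clique_number V E = Max {card K |K. K \<subseteq> V \<and> clique K E}"

text \<open>A colouring with colours \<open>{..<m}\<close>; no colour class contains a clique of size \<open>k\<close>.\<close>

definition clique_free_coloring ::
    "nat \<Rightarrow> 'a set \<Rightarrow> 'a set set \<Rightarrow> nat \<Rightarrow> ('a \<Rightarrow> nat) \<Rightarrow> bool" where
  "clique_free_coloring k V E m c \<longleftrightarrow>
     c ` V \<subseteq> {..<m} \<and> (\<forall>i<m. \<not> (\<exists>K \<in> [{v \<in> V. c v = i}]\<^bsup>k\<^esup>. clique K E))"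

text \<open>For finite \<open>V\<close> and \<open>k \<ge> 2\<close> the minimum below is attained, as the following lemma shows.
  (For \<open>k \<le> 1\<close> there may be no such colouring.)\<close>

definition clique_free_chromatic_number :: "nat \<Rightarrow> 'a set \<Rightarrow> 'a set set \<Rightarrow> nat" where
  "clique_free_chromatic_number k V E = (LEAST m. \<exists>c. clique_free_coloring k V E m c)"

lemma clique_free_coloring_exists:
  assumes "finite V" "k \<ge> 2"
  shows "\<exists>c. clique_free_coloring k V E (card V) c"
proof -
  obtain c where c: "bij_betw c V {..<card V}"
    using ex_bij_betw_finite_nat[OF assms(1)] by (auto simp: atLeast0LessThan)
  have False if "K \<in> [{v \<in> V. c v = i}]\<^bsup>k\<^esup>" for i K
  proof -
    have "inj_on c K" "c ` K \<subseteq> {i}" and k: "card K = k"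
      using that c by (auto simp: nsets_def bij_betw_def inj_on_def)
    then have "card K \<le> card {i}" by (metis card_inj_on_le finite.emptyI finite_insert)
    with k assms(2) show False by simp
  qed
  then show ?thesis
    using c unfolding clique_free_coloring_def bij_betw_def by blast
qed

definition overlap :: "'b set \<Rightarrow> 'b set \<Rightarrow> bool" where
  "overlap A B \<longleftrightarrow> A \<inter> B \<noteq> {} \<and> \<not> A \<subseteq> B \<and> \<not> B \<subseteq> A"

definition rectangles :: "(real \<times> real) set set" where
  "rectangles = {{a..b} \<times> {c..d} |a b c d. a < b \<and> c < d}"

text \<open>A representation is a bijection between the vertices and some set of rectangles; in
  particular, distinct vertices are represented by distinct rectangles.\<close>

definition rectangle_overlap_representation ::
    "'a set \<Rightarrow> 'a set set \<Rightarrow> ('a \<Rightarrow> (real \<times> real) set) \<Rightarrow> bool" where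
  "rectangle_overlap_representation V E \<mu> \<longleftrightarrow>
     (\<exists>R \<subseteq> rectangles. bij_betw \<mu> V R) \<and>
     (\<forall>u\<in>V. \<forall>v\<in>V. {u, v} \<in> E \<longleftrightarrow> overlap (\<mu> u) (\<mu> v))"

definition clean_representation :: "'a set \<Rightarrow> ('a \<Rightarrow> (real \<times> real) set) \<Rightarrow> bool" where
  "clean_representation V \<mu> \<longleftrightarrow>
     \<not> (\<exists>x\<in>V. \<exists>y\<in>V. \<exists>z\<in>V. overlap (\<mu> x) (\<mu> y) \<and> \<mu> z \<subseteq> \<mu> x \<inter> \<mu> y)"

definition clean_rectangle_overlap_graph :: "'a set \<Rightarrow> 'a set set \<Rightarrow> bool" where
  "clean_rectangle_overlap_graph V E \<longleftrightarrow>
     simple_graph V E \<and>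
     (\<exists>\<mu>. rectangle_overlap_representation V E \<mu> \<and> clean_representation V \<mu>)"

end

(*
  Rectangles are perturbed to general position, and crossing pairs, being comparable in a partial
  order, are separated by omega colours. Cleanness makes containment a forest. Cutting the paths of
  this forest suitably (the phase colouring) leaves only edges between members z, w of a common Q
  such that z overlaps some V that in turn overlaps Q.

  Rectangles through a common line are then properly colourable. A corner of a rectangle that lies
  in the intersection of two overlapping rectangles forces the rectangle across one of two lines, so
  one may assume that no two overlapping rectangles have corresponding corners in such an
  intersection. A further phase colouring makes every overlapping pair lie below an overlapping
  pair (U, W) in which one side interval contains the other. Now no rectangle has both a neighbour
  containing its x-interval and a neighbour containing its y-interval (an elbow), so the family splits into
  two parts, each with only horizontal or only vertical overlaps. In the horizontal case a last phase
  colouring allows one to assume that, of two overlapping rectangles, the left one never has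
  the smaller y-interval; then no triangle remains after making all pairs linked.
*)
theory Submission
  imports Defs
begin

section \<open>Colourings of finite relations\<close>

text \<open>The obstacle is containment: many nested rectangles can share a point, so depth at a
  point is bounded only on antichains, where meeting means overlapping. Phase colourings answer this
  by localising the problem below one \<open>Q\<close>, where every overlap leaving \<open>Q\<close>
  is witnessed by an antichain of prongs. Most colour bounds come from one device: if certain
  overlaps can be oriented transitively, their chains are cliques, and heights colour them with
  \<open>w\<close> colours. Much of the geometry below only proves such a transitivity. Cleanness
  acts in three ways: the containers of a rectangle form a chain; a rectangle inside
  \<open>Q\<close> that meets a prong of \<open>Q\<close> overlaps it; a rectangle with a corner in
  the intersection of an overlapping pair must leave that intersection. All conditions pass to
  colour classes except links, whose witnesses are therefore sought in the surrounding family. Every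
  step separates pairs, except the very last one, which tolerates edges and excludes only triangles;
  this is why the bound is for triangle-free classes and not for proper colourings.\<close>

definition colourable :: "'a set \<Rightarrow> ('a \<Rightarrow> 'a \<Rightarrow> bool) \<Rightarrow> nat \<Rightarrow> bool" where
  "colourable V E n \<longleftrightarrow> (\<exists>f. (\<forall>x\<in>V. f x < n) \<and> (\<forall>x\<in>V. \<forall>y\<in>V. E x y \<longrightarrow> f x \<noteq> f y))"

lemma colourableI:
  assumes "\<And>x. x \<in> V \<Longrightarrow> f x < n" "\<And>x y. x \<in> V \<Longrightarrow> y \<in> V \<Longrightarrow> E x y \<Longrightarrow> f x \<noteq> f y"
  shows "colourable V E n"
  unfolding colourable_def by (rule exI[of _ f]) (use assms in simp)

lemma colourableE:
  assumes "colourable V E n"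
  obtains f where "\<And>x. x \<in> V \<Longrightarrow> f x < n" "\<And>x y. x \<in> V \<Longrightarrow> y \<in> V \<Longrightarrow> E x y \<Longrightarrow> f x \<noteq> f y"
  using assms unfolding colourable_def by auto

lemma colourable_mono:
  assumes "colourable V E n" "n \<le> m" "\<And>x y. x \<in> U \<Longrightarrow> y \<in> U \<Longrightarrow> E' x y \<Longrightarrow> E x y" "U \<subseteq> V"
  shows "colourable U E' m"
  using assms(1)
proof (rule colourableE)
  fix f assume f: "\<And>x. x \<in> V \<Longrightarrow> f x < n" "\<And>x y. x \<in> V \<Longrightarrow> y \<in> V \<Longrightarrow> E x y \<Longrightarrow> f x \<noteq> f y"
  show ?thesis
  proof (rule colourableI[of _ f])
    show "f x < m" if "x \<in> U" for x using f(1)[of x] that assms(2,4) by auto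
    show "f x \<noteq> f y" if "x \<in> U" "y \<in> U" "E' x y" for x y
      using f(2)[of x y] that assms(3,4) by auto
  qed
qed

text \<open>Product colourings are encoded as \<open>x * m + y\<close> with \<open>y < m\<close>;
  this bound and the injectivity below keep pairs of colours natural numbers.\<close>

lemma pair_code_less:
  assumes "x < n" "y < (m::nat)"
  shows "x * m + y < n * m"
proof -
  have "x * m + y < Suc x * m" using assms(2) by simp
  also have "\<dots> \<le> n * m" using assms(1) by (intro mult_le_mono1) simp
  finally show ?thesis .
qed

lemma pair_code_inj:
  assumes "x * m + y = x' * m + y'" "y < m" "y' < (m::nat)"
  shows "x = x' \<and> y = y'"
proof -
  have "(x * m + y) div m = x" "(x' * m + y') div m = x'" using assms(2,3) by auto
  then show ?thesis using assms(1) by simp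
qed

lemma colourable_Un:
  assumes "colourable V E1 n" "colourable V E2 m"
  shows "colourable V (\<lambda>x y. E1 x y \<or> E2 x y) (n * m)"
proof -
  obtain f where f: "\<forall>x\<in>V. f x < n" "\<forall>x\<in>V. \<forall>y\<in>V. E1 x y \<longrightarrow> f x \<noteq> f y"
    using assms(1) unfolding colourable_def by blast
  obtain g where g: "\<forall>x\<in>V. g x < m" "\<forall>x\<in>V. \<forall>y\<in>V. E2 x y \<longrightarrow> g x \<noteq> g y"
    using assms(2) unfolding colourable_def by blast
  have "\<forall>x\<in>V. f x * m + g x < n * m" using f(1) g(1) by (simp add: pair_code_less)
  moreover have "\<forall>x\<in>V. \<forall>y\<in>V. E1 x y \<or> E2 x y \<longrightarrow> f x * m + g x \<noteq> f y * m + g y"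
    using f g pair_code_inj by metis
  ultimately show ?thesis unfolding colourable_def by (intro exI[of _ "\<lambda>x. f x * m + g x"]) blast
qed

text \<open>No edge leaves a group, so all groups may reuse the same \<open>m\<close>
  colours.\<close>

lemma colourable_groups:
  assumes "\<And>x y. x \<in> V \<Longrightarrow> y \<in> V \<Longrightarrow> E x y \<Longrightarrow> k x = k y"
    and "\<And>c. colourable {x\<in>V. k x = c} E m"
  shows "colourable V E m"
proof -
  have "\<forall>c. \<exists>f. (\<forall>x\<in>{x\<in>V. k x = c}. f x < m) \<and>
      (\<forall>x\<in>{x\<in>V. k x = c}. \<forall>y\<in>{x\<in>V. k x = c}. E x y \<longrightarrow> f x \<noteq> f y)"
    using assms(2) unfolding colourable_def by blast
  then obtain f where f: "\<forall>c. (\<forall>x\<in>{x\<in>V. k x = c}. f c x < m) \<and>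
      (\<forall>x\<in>{x\<in>V. k x = c}. \<forall>y\<in>{x\<in>V. k x = c}. E x y \<longrightarrow> f c x \<noteq> f c y)"
    by (rule choice[THEN exE])
  show ?thesis
  proof (rule colourableI[where f = "\<lambda>x. f (k x) x"])
    fix x y assume "x \<in> V" "y \<in> V" "E x y"
    then show "f (k x) x \<noteq> f (k y) y" using f assms(1)[of x y] by auto
  qed (use f in auto)
qed

lemma colourable_split:
  assumes "\<And>x. x \<in> V \<Longrightarrow> f x < n" "\<And>i. i < n \<Longrightarrow> colourable {x\<in>V. f x = i} E m"
  shows "colourable V E (n * m)"
proof -
  have "colourable V (\<lambda>x y. f x \<noteq> f y) n" unfolding colourable_def using assms(1) by blast
  moreover have "colourable V (\<lambda>x y. E x y \<and> f x = f y) m"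
  proof (rule colourable_groups[where k = f])
    fix c show "colourable {x\<in>V. f x = c} (\<lambda>x y. E x y \<and> f x = f y) m"
    proof (cases "c < n")
      case True
      from assms(2)[OF this] show ?thesis by (rule colourable_mono) auto
    next
      case False
      then have "{x\<in>V. f x = c} = {}" using assms(1) by auto
      then show ?thesis by (auto simp: colourable_def)
    qed
  qed auto
  ultimately have "colourable V (\<lambda>x y. f x \<noteq> f y \<or> (E x y \<and> f x = f y)) (n * m)" by (rule colourable_Un)
  then show ?thesis by (rule colourable_mono) auto
qed

lemma colourable_finite_Union:
  assumes "\<And>i. i < k \<Longrightarrow> colourable V (E i) n"
  shows "colourable V (\<lambda>x y. \<exists>i<k. E i x y) (n ^ k)"
  using assms
proof (induction k)
  case 0 show ?case unfolding colourable_def by (rule exI[of _ "\<lambda>_. 0"]) auto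
next
  case (Suc k)
  have "colourable V (\<lambda>x y. E k x y \<or> (\<exists>i<k. E i x y)) (n * n ^ k)"
    using Suc by (intro colourable_Un) auto
  then show ?case by (rule colourable_mono) (auto simp: less_Suc_eq)
qed

text \<open>The colour of \<open>x\<close> is the size of the largest chain strictly below it. In
  the applications \<open>R\<close> orients a part of the overlap relation, so chains are cliques
  and \<open>w\<close> is the clique bound; only transitivity is left to prove.\<close>

lemma colourable_heights:
  assumes fin: "finite V"
    and trans: "\<And>x y z. x \<in> V \<Longrightarrow> y \<in> V \<Longrightarrow> z \<in> V \<Longrightarrow> R x y \<Longrightarrow> R y z \<Longrightarrow> R x z"
    and irr: "\<And>x. x \<in> V \<Longrightarrow> \<not> R x x"
    and chain: "\<And>K. K \<subseteq> V \<Longrightarrow> (\<And>x y. x \<in> K \<Longrightarrow> y \<in> K \<Longrightarrow> x \<noteq> y \<Longrightarrow> R x y \<or> R y x) \<Longrightarrow> card K \<le> w"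
  shows "colourable V (\<lambda>x y. R x y \<or> R y x) w"
proof -
  define ch where "ch K \<longleftrightarrow> K \<subseteq> V \<and> (\<forall>a\<in>K. \<forall>c\<in>K. a \<noteq> c \<longrightarrow> R a c \<or> R c a)" for K
  define S where "S x = {K. ch K \<and> (\<forall>a\<in>K. R a x)}" for x
  define h where "h x = Max (card ` S x)" for x
  have chV: "K \<subseteq> V" if "ch K" for K using that by (simp add: ch_def)
  have finS: "finite (S x)" for x
    by (rule finite_subset[of _ "Pow V"]) (use fin chV in \<open>auto simp: S_def\<close>)
  have neS: "{} \<in> S x" for x by (simp add: S_def ch_def)
  have hK: "\<exists>K\<in>S x. card K = h x" for x
  proof -
    have "h x \<in> card ` S x" unfolding h_def using finS neS by (intro Max_in) auto
    then show ?thesis by auto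
  qed
  have ins: "ch (insert x K)" "card (insert x K) = Suc (card K)" if "K \<in> S x" "x \<in> V" for x K
  proof -
    have K: "ch K" "\<And>a. a \<in> K \<Longrightarrow> R a x" using that(1) by (auto simp: S_def)
    show "ch (insert x K)" using K that(2) unfolding ch_def by blast
    have "x \<notin> K" using K(2)[of x] irr that(2) by auto
    moreover have "finite K" using chV[OF K(1)] fin finite_subset by auto
    ultimately show "card (insert x K) = Suc (card K)" by simp
  qed
  have lt: "h x < w" if "x \<in> V" for x
  proof -
    obtain K where K: "K \<in> S x" "card K = h x" using hK by auto
    have "card (insert x K) \<le> w" using ins(1)[OF K(1) that] unfolding ch_def by (intro chain) auto
    then show ?thesis using ins(2)[OF K(1) that] K(2) by simp
  qed
  have inc: "h x < h y" if "R x y" "x \<in> V" "y \<in> V" for x y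
  proof -
    obtain K where K: "K \<in> S x" "card K = h x" using hK by auto
    have "\<And>a. a \<in> K \<Longrightarrow> R a y"
      using K(1) chV that trans[of _ x y] unfolding S_def by blast
    then have "insert x K \<in> S y" using ins(1)[OF K(1) that(2)] that(1) by (auto simp: S_def)
    then have "card (insert x K) \<le> h y" unfolding h_def using finS by (intro Max_ge) auto
    then show ?thesis using ins(2)[OF K(1) that(2)] K(2) by simp
  qed
  show ?thesis
  proof (rule colourableI[of _ h])
    fix x y assume "x \<in> V" "y \<in> V" "R x y \<or> R y x"
    then show "h x \<noteq> h y" using inc[of x y] inc[of y x] by auto
  qed (rule lt)
qed

text \<open>Counting arcs twice gives a vertex \<open>v\<close> of indegree at most
  \<open>k\<close>, hence with at most \<open>2 * k\<close> neighbours. Colour the rest by induction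
  and give \<open>v\<close> a colour missing on its neighbours.\<close>

lemma colourable_outdegree:
  assumes "finite V" "\<And>x. x \<in> V \<Longrightarrow> card {y\<in>V. D x y} \<le> k"
  shows "colourable V (\<lambda>x y. x \<noteq> y \<and> (D x y \<or> D y x)) (2 * k + 1)"
  using assms
proof (induction "card V" arbitrary: V)
  case 0
  then show ?case by (auto simp: colourable_def)
next
  case (Suc n)
  let ?E = "\<lambda>x y. x \<noteq> y \<and> (D x y \<or> D y x)"
  have "(\<Sum>x\<in>V. card {y\<in>V. D y x}) = (\<Sum>x\<in>V. \<Sum>y\<in>V. if D y x then 1 else 0)"
    using Suc.prems(1) by (intro sum.cong refl) (simp add: sum.If_cases Int_def)
  also have "\<dots> = (\<Sum>y\<in>V. \<Sum>x\<in>V. if D y x then 1 else 0)" by (rule sum.swap)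
  also have "\<dots> = (\<Sum>y\<in>V. card {x\<in>V. D y x})"
    using Suc.prems(1) by (intro sum.cong refl) (simp add: sum.If_cases Int_def)
  also have "\<dots> \<le> (\<Sum>y\<in>V. k)" using Suc.prems(2) by (intro sum_mono) auto
  finally have le: "(\<Sum>x\<in>V. card {y\<in>V. D y x}) \<le> card V * k" by simp
  have "\<exists>v\<in>V. card {y\<in>V. D y v} \<le> k"
  proof (rule ccontr)
    assume "\<not> ?thesis"
    then have "\<And>x. x \<in> V \<Longrightarrow> Suc k \<le> card {y\<in>V. D y x}" by (metis not_less_eq_eq)
    then have "(\<Sum>x\<in>V. Suc k) \<le> (\<Sum>x\<in>V. card {y\<in>V. D y x})" by (intro sum_mono) auto
    with le have "card V * Suc k \<le> card V * k" by simp
    with Suc(2) show False by simp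
  qed
  then obtain v where v: "v \<in> V" "card {y\<in>V. D y v} \<le> k" by blast
  let ?U = "V - {v}"
  have "colourable ?U ?E (2 * k + 1)"
  proof (rule Suc.hyps(1))
    show "n = card ?U" using Suc v by simp
    fix x assume "x \<in> ?U"
    have "card {y\<in>?U. D x y} \<le> card {y\<in>V. D x y}"
      using Suc.prems(1) by (intro card_mono) auto
    then show "card {y\<in>?U. D x y} \<le> k" using Suc.prems(2) \<open>x \<in> ?U\<close> by fastforce
  qed (use Suc in auto)
  then obtain f where f: "\<And>x. x \<in> ?U \<Longrightarrow> f x < 2 * k + 1"
      "\<And>x y. x \<in> ?U \<Longrightarrow> y \<in> ?U \<Longrightarrow> ?E x y \<Longrightarrow> f x \<noteq> f y"
    by (elim colourableE) blast
  define N where "N = {y\<in>V. D y v} \<union> {y\<in>V. D v y}"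
  have "card N \<le> 2 * k" unfolding N_def
    using v Suc.prems(2)[OF v(1)] card_Un_le[of "{y\<in>V. D y v}" "{y\<in>V. D v y}"] by linarith
  moreover have "finite N" using Suc.prems(1) by (auto simp: N_def)
  ultimately have "card (f ` N) < card {..<2 * k + 1}" using card_image_le[of N f] by simp
  then have "\<not> {..<2 * k + 1} \<subseteq> f ` N"
    using \<open>finite N\<close> card_mono[of "f ` N" "{..<2 * k + 1}"] by fastforce
  then obtain c where c: "c < 2 * k + 1" "c \<notin> f ` N" by auto
  show ?case
  proof (rule colourableI[where f = "f(v := c)"])
    fix x assume "x \<in> V" then show "(f(v := c)) x < 2 * k + 1" using c f(1)[of x] by auto
  next
    fix x y assume xy: "x \<in> V" "y \<in> V" "?E x y"
    consider "x = v" "y \<in> N" "y \<noteq> v" | "y = v" "x \<in> N" "x \<noteq> v" | "x \<in> ?U" "y \<in> ?U"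
      using xy by (auto simp: N_def)
    then show "(f(v := c)) x \<noteq> (f(v := c)) y"
      using c f(2)[of x y] xy by cases auto
  qed
qed

text \<open>The form in which one passes to families without pairs in \<open>E'\<close>, at the
  price of a factor \<open>n\<close>.\<close>

lemma colourable_classes:
  assumes "colourable V E' n"
    and "\<And>D. D \<subseteq> V \<Longrightarrow> (\<And>x y. x \<in> D \<Longrightarrow> y \<in> D \<Longrightarrow> \<not> E' x y) \<Longrightarrow> colourable D E m"
  shows "colourable V E (n * m)"
  using assms(1)
proof (rule colourableE)
  fix f assume f: "\<And>x. x \<in> V \<Longrightarrow> f x < n" "\<And>x y. x \<in> V \<Longrightarrow> y \<in> V \<Longrightarrow> E' x y \<Longrightarrow> f x \<noteq> f y"
  show ?thesis
  proof (rule colourable_split[where f = f])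
    fix i show "colourable {x\<in>V. f x = i} E m" by (rule assms(2)) (use f(2) in force)+
  qed (rule f(1))
qed

section \<open>Colourings without monochromatic triangles\<close>

definition tf_colourable :: "'a set \<Rightarrow> ('a \<Rightarrow> 'a \<Rightarrow> bool) \<Rightarrow> nat \<Rightarrow> bool" where
  "tf_colourable V E n \<longleftrightarrow> (\<exists>f. (\<forall>x\<in>V. f x < n) \<and>
     (\<forall>x\<in>V. \<forall>y\<in>V. \<forall>z\<in>V. E x y \<and> E y z \<and> E x z \<longrightarrow> \<not> (f x = f y \<and> f y = f z)))"

lemma tf_colourableI:
  assumes "\<And>x. x \<in> V \<Longrightarrow> f x < n"
    and "\<And>x y z. x \<in> V \<Longrightarrow> y \<in> V \<Longrightarrow> z \<in> V \<Longrightarrow> E x y \<Longrightarrow> E y z \<Longrightarrow> E x z \<Longrightarrow> f x = f y \<Longrightarrow> f y = f z \<Longrightarrow> False"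
  shows "tf_colourable V E n"
  unfolding tf_colourable_def by (rule exI[of _ f]) (use assms in blast)

lemma tf_colourableE:
  assumes "tf_colourable V E n"
  obtains f where "\<And>x. x \<in> V \<Longrightarrow> f x < n"
    "\<And>x y z. x \<in> V \<Longrightarrow> y \<in> V \<Longrightarrow> z \<in> V \<Longrightarrow> E x y \<Longrightarrow> E y z \<Longrightarrow> E x z \<Longrightarrow> f x = f y \<Longrightarrow> f y = f z \<Longrightarrow> False"
  using assms unfolding tf_colourable_def by (elim exE conjE) (rule that, blast+)

lemma tf_colourable_classes:
  assumes "colourable V E' n"
    and "\<And>D. D \<subseteq> V \<Longrightarrow> (\<And>x y. x \<in> D \<Longrightarrow> y \<in> D \<Longrightarrow> \<not> E' x y) \<Longrightarrow> tf_colourable D E m"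
  shows "tf_colourable V E (n * m)"
  using assms(1)
proof (rule colourableE)
  fix f assume f: "\<And>x. x \<in> V \<Longrightarrow> f x < n" "\<And>x y. x \<in> V \<Longrightarrow> y \<in> V \<Longrightarrow> E' x y \<Longrightarrow> f x \<noteq> f y"
  have "\<forall>i. \<exists>g. (\<forall>x\<in>{x\<in>V. f x = i}. g x < m) \<and> (\<forall>x\<in>{x\<in>V. f x = i}. \<forall>y\<in>{x\<in>V. f x = i}.
      \<forall>z\<in>{x\<in>V. f x = i}. E x y \<and> E y z \<and> E x z \<longrightarrow> \<not> (g x = g y \<and> g y = g z))"
  proof
    fix i
    have "tf_colourable {x\<in>V. f x = i} E m" by (rule assms(2)) (use f(2) in force)+
    then show "\<exists>g. (\<forall>x\<in>{x\<in>V. f x = i}. g x < m) \<and> (\<forall>x\<in>{x\<in>V. f x = i}. \<forall>y\<in>{x\<in>V. f x = i}.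
      \<forall>z\<in>{x\<in>V. f x = i}. E x y \<and> E y z \<and> E x z \<longrightarrow> \<not> (g x = g y \<and> g y = g z))"
      unfolding tf_colourable_def .
  qed
  then obtain g where g: "\<forall>i. (\<forall>x\<in>{x\<in>V. f x = i}. g i x < m) \<and> (\<forall>x\<in>{x\<in>V. f x = i}. \<forall>y\<in>{x\<in>V. f x = i}.
      \<forall>z\<in>{x\<in>V. f x = i}. E x y \<and> E y z \<and> E x z \<longrightarrow> \<not> (g i x = g i y \<and> g i y = g i z))"
    by (rule choice[THEN exE])
  have lt: "g (f x) x < m" if "x \<in> V" for x using g that by auto
  show ?thesis
  proof (rule tf_colourableI[where f = "\<lambda>x. f x * m + g (f x) x"])
    show "f x * m + g (f x) x < n * m" if "x \<in> V" for x using f(1) lt that by (intro pair_code_less)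
    fix x y z assume *: "x \<in> V" "y \<in> V" "z \<in> V" "E x y" "E y z" "E x z"
      "f x * m + g (f x) x = f y * m + g (f y) y" "f y * m + g (f y) y = f z * m + g (f z) z"
    have "f x = f y \<and> g (f x) x = g (f y) y" using *(1,2,7) lt by (intro pair_code_inj)
    moreover have "f y = f z \<and> g (f y) y = g (f z) z" using *(2,3,8) lt by (intro pair_code_inj)
    ultimately show False using g[rule_format, of "f x"] *(1-6) by auto
  qed
qed

lemma tf_colourable_mono:
  assumes "tf_colourable V E n" "n \<le> m" "U \<subseteq> V" "\<And>x y. x \<in> U \<Longrightarrow> y \<in> U \<Longrightarrow> E' x y \<Longrightarrow> E x y"
  shows "tf_colourable U E' m"
  using assms(1)
proof (rule tf_colourableE)
  fix f assume f: "\<And>x. x \<in> V \<Longrightarrow> f x < n"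
    "\<And>x y z. x \<in> V \<Longrightarrow> y \<in> V \<Longrightarrow> z \<in> V \<Longrightarrow> E x y \<Longrightarrow> E y z \<Longrightarrow> E x z \<Longrightarrow> f x = f y \<Longrightarrow> f y = f z \<Longrightarrow> False"
  show ?thesis
  proof (rule tf_colourableI[of _ f])
    show "f x < m" if "x \<in> U" for x using f(1)[of x] that assms(2,3) by auto
    show False if "x \<in> U" "y \<in> U" "z \<in> U" "E' x y" "E' y z" "E' x z" "f x = f y" "f y = f z" for x y z
      using f(2)[of x y z] that assms(3,4) by blast
  qed
qed

lemma tf_colourable_trivial: "(\<And>x y z. x \<in> V \<Longrightarrow> y \<in> V \<Longrightarrow> z \<in> V \<Longrightarrow> E x y \<Longrightarrow> E y z \<Longrightarrow> E x z \<Longrightarrow> False) \<Longrightarrow> tf_colourable V E 1"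
  by (rule tf_colourableI[where f = "\<lambda>_. 0"]) auto

section \<open>Phase colourings of forests\<close>

text \<open>Arcs \<open>P q x\<close> increase \<open>r\<close>, so an element of maximal
  \<open>r\<close> has no outgoing arc and decides nothing about the others. Remove it, take a
  kernel of the rest, and add it back exactly when no kernel element points to it.\<close>

lemma finite_kernel:
  assumes "finite C" "\<And>q x. q \<in> C \<Longrightarrow> x \<in> C \<Longrightarrow> P q x \<Longrightarrow> (r q :: nat) < r x"
  shows "\<exists>K\<subseteq>C. \<forall>x\<in>C. x \<in> K \<longleftrightarrow> (\<forall>q\<in>K. \<not> P q x)"
  using assms
proof (induction "card C" arbitrary: C)
  case 0
  then show ?case by auto
next
  case (Suc n)
  then have "C \<noteq> {}" by auto
  have "Max (r ` C) \<in> r ` C" using \<open>finite C\<close> \<open>C \<noteq> {}\<close> by (intro Max_in) auto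
  then obtain x where x: "x \<in> C" "r x = Max (r ` C)" by auto
  have max: "\<not> P x y" if "y \<in> C" for y
  proof
    assume "P x y"
    then have "r x < r y" using Suc.prems(2) x(1) that by simp
    moreover have "r y \<le> r x" unfolding x(2) using that \<open>finite C\<close> by (intro Max_ge) auto
    ultimately show False by simp
  qed
  obtain K where K: "K \<subseteq> C - {x}" "\<forall>y\<in>C - {x}. y \<in> K \<longleftrightarrow> (\<forall>q\<in>K. \<not> P q y)"
  proof -
    have "n = card (C - {x})" using Suc.hyps(2) \<open>finite C\<close> x(1) by simp
    moreover have "finite (C - {x})" using \<open>finite C\<close> by simp
    moreover have "r q < r y" if "q \<in> C - {x}" "y \<in> C - {x}" "P q y" for q y
      using Suc.prems(2) that by simp
    ultimately show ?thesis using Suc.hyps(1)[of "C - {x}"] that by blast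
  qed
  show ?case
  proof (cases "\<forall>q\<in>K. \<not> P q x")
    case True
    show ?thesis
      by (rule exI[of _ "insert x K"]) (use K True max x(1) in auto)
  next
    case False
    show ?thesis
      by (rule exI[of _ K]) (use K False in auto)
  qed
qed

text \<open>
  Each \<open>x\<close> climbs to the least element \<open>g x\<close> of a kernel \<open>K\<close>, and \<open>x\<close> itself is put into \<open>K\<close>
  exactly when none of its \<open>H\<close>-neighbours escapes from any \<open>q \<in> K\<close> above \<open>x\<close>. The kernel
  paths of two \<open>H\<close>-neighbours differ by at most one element on each side, so the parity of the
  path length, together with a colouring of each kernel level, separates them unless they
  climb to the same element.
\<close>

lemma phase_colouring:
  fixes C :: "'a set" and le ov H :: "'a \<Rightarrow> 'a \<Rightarrow> bool"
  assumes fin: "finite C"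
    and refl: "\<And>x. x \<in> C \<Longrightarrow> le x x"
    and trans: "\<And>x y z. x \<in> C \<Longrightarrow> y \<in> C \<Longrightarrow> z \<in> C \<Longrightarrow> le x y \<Longrightarrow> le y z \<Longrightarrow> le x z"
    and antisym: "\<And>x y. x \<in> C \<Longrightarrow> y \<in> C \<Longrightarrow> le x y \<Longrightarrow> le y x \<Longrightarrow> x = y"
    and chain: "\<And>x y z. x \<in> C \<Longrightarrow> y \<in> C \<Longrightarrow> z \<in> C \<Longrightarrow> le z x \<Longrightarrow> le z y \<Longrightarrow> le x y \<or> le y x"
    and ov_sym: "\<And>x y. x \<in> C \<Longrightarrow> y \<in> C \<Longrightarrow> ov x y \<Longrightarrow> ov y x"
    and ov_le: "\<And>x y. x \<in> C \<Longrightarrow> y \<in> C \<Longrightarrow> ov x y \<Longrightarrow> \<not> le x y"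
    and ov_up: "\<And>z w x. z \<in> C \<Longrightarrow> w \<in> C \<Longrightarrow> x \<in> C \<Longrightarrow> ov z w \<Longrightarrow> le z x \<Longrightarrow> \<not> le w x \<Longrightarrow> ov x w"
    and anti: "\<And>A. A \<subseteq> C \<Longrightarrow> (\<And>x y. x \<in> A \<Longrightarrow> y \<in> A \<Longrightarrow> le x y \<Longrightarrow> x = y) \<Longrightarrow> colourable A ov \<alpha>"
    and H_ov: "\<And>x y. x \<in> C \<Longrightarrow> y \<in> C \<Longrightarrow> H x y \<Longrightarrow> ov x y"
    and H_sym: "\<And>x y. x \<in> C \<Longrightarrow> y \<in> C \<Longrightarrow> H x y \<Longrightarrow> H y x"
    and H_up: "\<And>z w x. z \<in> C \<Longrightarrow> w \<in> C \<Longrightarrow> x \<in> C \<Longrightarrow> H z w \<Longrightarrow> le z x \<Longrightarrow> \<not> le w x \<Longrightarrow> H x w"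
  obtains f g where "\<And>x. x \<in> C \<Longrightarrow> f x < 2 * \<alpha>"
    and "\<And>z w. z \<in> C \<Longrightarrow> w \<in> C \<Longrightarrow> H z w \<Longrightarrow> f z = f w \<Longrightarrow>
      g z = g w \<and> g z \<in> C \<and> le z (g z) \<and> z \<noteq> g z \<and> (\<exists>v\<in>C. H z v \<and> \<not> le v (g z))"
proof -
  define P where "P q x \<longleftrightarrow> le x q \<and> x \<noteq> q \<and> (\<exists>v\<in>C. H x v \<and> \<not> le v q)" for q x
  define r where "r x = card {q\<in>C. le x q}" for x
  have r_less: "r q < r x" if "q \<in> C" "x \<in> C" "le x q" "x \<noteq> q" for q x
    unfolding r_def
  proof (rule psubset_card_mono)
    have "{y\<in>C. le q y} \<subseteq> {y\<in>C. le x y}" using trans that by blast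
    moreover have "x \<in> {y\<in>C. le x y}" "x \<notin> {y\<in>C. le q y}" using antisym refl that by auto
    ultimately show "{y\<in>C. le q y} \<subset> {y\<in>C. le x y}" by blast
  qed (use fin in auto)
  have "\<exists>K\<subseteq>C. \<forall>x\<in>C. x \<in> K \<longleftrightarrow> (\<forall>q\<in>K. \<not> P q x)"
    using fin by (rule finite_kernel[where r = r]) (auto simp: P_def intro: r_less)
  then obtain K where KC: "K \<subseteq> C" and K: "\<And>x. x \<in> C \<Longrightarrow> x \<in> K \<longleftrightarrow> (\<forall>q\<in>K. \<not> P q x)" by auto
  define U where "U x = {q\<in>K. le x q}" for x
  have U_C: "U x \<subseteq> C" and finU: "finite (U x)" for x
    using KC finite_subset[OF KC fin] by (auto simp: U_def)
  have chainU: "le p q \<or> le q p" if "x \<in> C" "p \<in> U x" "q \<in> U x" for x p q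
    using chain[of p q x] that U_C by (auto simp: U_def)
  have U_ne: "U x \<noteq> {}" if "x \<in> C" for x
  proof -
    define A where "A = {q\<in>C. le x q}"
    have A: "finite A" "A \<noteq> {}" using fin refl that by (auto simp: A_def)
    \<comment> \<open>The element \<open>m\<close> above \<open>x\<close> with fewest elements above
      itself is maximal, whereas \<open>P q m\<close> needs \<open>q\<close> strictly above
      \<open>m\<close>. So \<open>m\<close> is in the kernel.\<close>
    have "Min (r ` A) \<in> r ` A" using A by (intro Min_in) auto
    then obtain m where m: "m \<in> A" "r m = Min (r ` A)" by auto
    have "\<not> P q m" if "q \<in> K" for q
    proof
      assume "P q m"
      then have "q \<in> A" using m KC \<open>q \<in> K\<close> \<open>x \<in> C\<close> trans[of x m q] by (auto simp: A_def P_def)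
      then have "r m \<le> r q" unfolding m(2) using A by (intro Min_le) auto
      moreover have "r q < r m" using \<open>P q m\<close> m(1) KC \<open>q \<in> K\<close>
        by (intro r_less) (auto simp: A_def P_def)
      ultimately show False by simp
    qed
    then have "m \<in> K" using K m by (auto simp: A_def)
    then show ?thesis using m by (auto simp: A_def U_def)
  qed
  have "\<exists>q. q \<in> U x \<and> (\<forall>p\<in>U x. le q p)" if x: "x \<in> C" for x
  proof -
    have "Max (r ` U x) \<in> r ` U x" using finU U_ne x by (intro Max_in) auto
    then obtain m where m: "m \<in> U x" "r m = Max (r ` U x)" by auto
    have "le m p" if p: "p \<in> U x" for p
    proof (rule ccontr)
      assume "\<not> le m p"
      then have "le p m" "p \<noteq> m" using chainU[OF x p m(1)] refl m U_C by auto
      then have "r m < r p" using subsetD[OF U_C p] subsetD[OF U_C m(1)] by (intro r_less)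
      moreover have "r p \<le> r m" unfolding m(2) using p finU by (intro Max_ge) auto
      ultimately show False by simp
    qed
    then show ?thesis using m by auto
  qed
  then have ex: "\<forall>x\<in>C. \<exists>q. q \<in> U x \<and> (\<forall>p\<in>U x. le q p)" by blast
  obtain g where g0: "\<forall>x\<in>C. g x \<in> U x \<and> (\<forall>p\<in>U x. le (g x) p)"
    using bchoice[OF ex] by (elim exE) (rule that)
  have g: "\<And>x. x \<in> C \<Longrightarrow> g x \<in> U x" "\<And>x p. x \<in> C \<Longrightarrow> p \<in> U x \<Longrightarrow> le (g x) p"
    using g0 by auto
  have gC: "g x \<in> C" and gK: "g x \<in> K" and le_g: "le x (g x)" if "x \<in> C" for x
    using g(1)[OF that] KC by (auto simp: U_def)
  have U_g: "U (g x) = U x" if "x \<in> C" for x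
    using g(2) that le_g gC KC trans[of x "g x"] by (auto simp: U_def)
  define \<phi> where "\<phi> x = card (U x)" for x
  \<comment> \<open>Elements of the kernel on one level \<open>j\<close> are pairwise incomparable,
    so \<open>anti\<close> colours each level separately.\<close>
  have "\<exists>h. \<forall>j. (\<forall>x\<in>{q\<in>K. \<phi> q = j}. h j x < \<alpha>) \<and>
     (\<forall>x\<in>{q\<in>K. \<phi> q = j}. \<forall>y\<in>{q\<in>K. \<phi> q = j}. ov x y \<longrightarrow> h j x \<noteq> h j y)"
  proof (rule choice, rule allI)
    fix j
    have "colourable {q\<in>K. \<phi> q = j} ov \<alpha>"
    proof (rule anti)
      fix p q assume pq: "p \<in> {q\<in>K. \<phi> q = j}" "q \<in> {q\<in>K. \<phi> q = j}" "le p q"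
      show "p = q"
      proof (rule ccontr)
        assume "p \<noteq> q"
        have C: "p \<in> K" "q \<in> K" "p \<in> C" "q \<in> C" using pq KC by auto
        then have "U q \<subseteq> U p" using pq(3) KC trans[of p q] by (auto simp: U_def)
        moreover have "p \<in> U p" "p \<notin> U q" using C pq(3) refl antisym[of p q] \<open>p \<noteq> q\<close> by (auto simp: U_def)
        ultimately have "U q \<subset> U p" by blast
        then have "\<phi> q < \<phi> p" unfolding \<phi>_def using finU by (intro psubset_card_mono)
        then show False using pq by simp
      qed
    qed (use KC in auto)
    then show "\<exists>h. (\<forall>x\<in>{q\<in>K. \<phi> q = j}. h x < \<alpha>) \<and>
     (\<forall>x\<in>{q\<in>K. \<phi> q = j}. \<forall>y\<in>{q\<in>K. \<phi> q = j}. ov x y \<longrightarrow> h x \<noteq> h y)"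
      by (simp add: colourable_def)
  qed
  then obtain h where h0: "\<forall>j. (\<forall>x\<in>{q\<in>K. \<phi> q = j}. h j x < \<alpha>) \<and>
     (\<forall>x\<in>{q\<in>K. \<phi> q = j}. \<forall>y\<in>{q\<in>K. \<phi> q = j}. ov x y \<longrightarrow> h j x \<noteq> h j y)"
    by (elim exE) (rule that)
  have h: "h (\<phi> q) q < \<alpha>" "\<phi> p = \<phi> q \<Longrightarrow> ov p q \<Longrightarrow> h (\<phi> p) p \<noteq> h (\<phi> q) q"
    if "q \<in> K" "p \<in> K" for p q
    using h0[rule_format, of "\<phi> q"] that by auto
  have \<phi>_g: "\<phi> (g x) = \<phi> x" if "x \<in> C" for x using U_g that by (simp add: \<phi>_def)
  define f where "f x = (\<phi> x mod 2) * \<alpha> + h (\<phi> (g x)) (g x)" for x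
  \<comment> \<open>If \<open>p\<close> is strictly below \<open>q\<close> and both lie on the path
    of \<open>z\<close> only, then \<open>H p w\<close> by \<open>H_up\<close>, and \<open>w\<close>
    escapes from \<open>q\<close>. Thus \<open>P q p\<close> holds, which keeps \<open>p\<close> out
    of the kernel.\<close>
  have N1: "p = q" if zw: "z \<in> C" "w \<in> C" "H z w" and p: "p \<in> U z - U w" and q: "q \<in> U z - U w" for z w p q
  proof -
    have False if "p \<in> U z - U w" "q \<in> U z - U w" "le p q" "p \<noteq> q" for p q
    proof -
      have C: "p \<in> C" "q \<in> C" using that U_C by auto
      have "H p w" using H_up[OF zw(1,2) C(1) zw(3)] that by (auto simp: U_def)
      moreover have "\<not> le w q" using that by (auto simp: U_def)
      ultimately have "P q p" using that zw by (auto simp: P_def)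
      then show False using K[OF C(1)] that by (auto simp: U_def)
    qed
    then show ?thesis using chainU[OF zw(1)] p q by blast
  qed
  have gN: "g z \<in> U z - U w" if zw: "z \<in> C" "w \<in> C" and p: "p \<in> U z - U w" for z w p
  proof -
    have "\<not> le w (g z)"
      using trans[of w "g z" p] g(2)[of z p] zw p U_C gC by (auto simp: U_def)
    then show ?thesis using g(1) zw by (auto simp: U_def)
  qed
  show thesis
  proof (rule that[of f g])
    fix x assume x: "x \<in> C"
    show "f x < 2 * \<alpha>" unfolding f_def using h(1)[OF gK[OF x] gK[OF x]] by (intro pair_code_less) auto
  next
    fix z w assume zw: "z \<in> C" "w \<in> C" "H z w" "f z = f w"
    then have wz: "H w z" using H_sym by blast
    have code: "\<phi> z mod 2 = \<phi> w mod 2" "h (\<phi> (g z)) (g z) = h (\<phi> (g w)) (g w)"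
      using pair_code_inj[OF zw(4)[unfolded f_def]] h(1)[OF gK gK] zw by auto
    have c1: "card (U z - U w) \<le> 1" "card (U w - U z) \<le> 1"
      using N1[OF zw(1,2,3)] N1[OF zw(2,1) wz] finU by (auto simp: card_le_Suc0_iff_eq)
    have sp: "\<phi> z = card (U z \<inter> U w) + card (U z - U w)" "\<phi> w = card (U z \<inter> U w) + card (U w - U z)"
      unfolding \<phi>_def using finU[of z] finU[of w]
      by (metis card_Int_Diff, metis card_Int_Diff Int_commute)
    \<comment> \<open>Both differences have size 0 or 1, and the path lengths have equal
      parity.\<close>
    have eq: "card (U z - U w) = card (U w - U z)"
      using c1 sp code(1) by presburger
    have "U z - U w = {}"
    proof (rule ccontr)
      assume "U z - U w \<noteq> {}"
      then obtain p where p: "p \<in> U z - U w" by blast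
      then have "card (U z - U w) \<noteq> 0" using finU[of z] by auto
      then have "U w - U z \<noteq> {}" using eq by (metis card.empty)
      then obtain q where q: "q \<in> U w - U z" by blast
      \<comment> \<open>One element remains on each side. These are \<open>g z\<close> and
        \<open>g w\<close>, which overlap and lie on the same level, so \<open>h\<close> gives them
        different colours.\<close>
      have gz: "g z \<in> U z - U w" "g w \<in> U w - U z" using gN p q zw by blast+
      have "ov (g z) w"
        using ov_up[OF zw(1,2) gC[OF zw(1)] H_ov[OF zw(1-3)]] gz by (auto simp: U_def)
      then have "ov w (g z)" using ov_sym zw gC by auto
      moreover have "\<not> le (g z) (g w)"
        using trans[of z "g z" "g w"] gz zw gC le_g by (auto simp: U_def)
      ultimately have "ov (g w) (g z)"
        using ov_up[OF zw(2) gC[OF zw(1)] gC[OF zw(2)]] le_g zw by blast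
      moreover have "\<phi> (g w) = \<phi> (g z)" using \<phi>_g sp eq zw by simp
      ultimately show False using h(2)[of "g z" "g w"] gK zw code(2) by auto
    qed
    moreover from this have "U w - U z = {}" using eq finU[of w] by (metis card.empty card_0_eq finite_Diff)
    ultimately have UU: "U z = U w" by blast
    have "g z = g w" using g zw UU gC by (intro antisym) auto
    \<comment> \<open>A kernel element \<open>z\<close> would lie on the common path, hence above
      \<open>w\<close>, although the two overlap. Being outside the kernel, \<open>z\<close> has a
      neighbour escaping from some \<open>q\<close>, and a fortiori from \<open>g z\<close> below
      \<open>q\<close>.\<close>
    moreover have nK: "z \<notin> K"
    proof
      assume "z \<in> K"
      then have "z \<in> U w" using refl zw UU by (auto simp: U_def)
      then show False using ov_le[of w z] H_ov[OF zw(2,1) wz] zw by (auto simp: U_def)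
    qed
    then obtain q where q: "q \<in> K" "P q z" using K zw by auto
    then obtain v where v: "v \<in> C" "H z v" "\<not> le v q" by (auto simp: P_def)
    have "le (g z) q" using g(2)[OF zw(1), of q] q by (auto simp: P_def U_def)
    then have "\<not> le v (g z)" using trans[of v "g z" q] v q KC gC zw by auto
    moreover have "z \<noteq> g z" using nK gK[OF zw(1)] by metis
    ultimately show "g z = g w \<and> g z \<in> C \<and> le z (g z) \<and> z \<noteq> g z \<and> (\<exists>v\<in>C. H z v \<and> \<not> le v (g z))"
      using gC le_g zw v by blast
  qed
qed

text \<open>Vertices outside \<open>A\<close> are isolated and share the colour 0, which exists
  since \<open>n > 0\<close>.\<close>

lemma colourable_support:
  assumes "colourable A E n" "n > 0" "\<And>x y. x \<in> V \<Longrightarrow> y \<in> V \<Longrightarrow> E x y \<Longrightarrow> x \<in> A \<and> y \<in> A"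
  shows "colourable V E n"
  using assms(1)
proof (rule colourableE)
  fix f assume f: "\<And>x. x \<in> A \<Longrightarrow> f x < n" "\<And>x y. x \<in> A \<Longrightarrow> y \<in> A \<Longrightarrow> E x y \<Longrightarrow> f x \<noteq> f y"
  show ?thesis
  proof (rule colourableI[where f = "\<lambda>x. if x \<in> A then f x else 0"])
    fix x y assume "x \<in> V" "y \<in> V" "E x y"
    then show "(if x \<in> A then f x else 0) \<noteq> (if y \<in> A then f y else 0)"
      using f(2)[of x y] assms(3)[of x y] by simp
  qed (use f(1) assms(2) in simp)
qed

lemma colourable_cover:
  assumes "colourable A E n" "colourable B E m" "V \<subseteq> A \<union> B"
  shows "colourable V E (n + m)"
  using assms(1)
proof (rule colourableE)
  fix f assume f: "\<And>x. x \<in> A \<Longrightarrow> f x < n" "\<And>x y. x \<in> A \<Longrightarrow> y \<in> A \<Longrightarrow> E x y \<Longrightarrow> f x \<noteq> f y"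
  show ?thesis using assms(2)
  proof (rule colourableE)
    fix g assume g: "\<And>x. x \<in> B \<Longrightarrow> g x < m" "\<And>x y. x \<in> B \<Longrightarrow> y \<in> B \<Longrightarrow> E x y \<Longrightarrow> g x \<noteq> g y"
    define h where "h x = (if x \<in> A then f x else n + g x)" for x
    show ?thesis
    proof (rule colourableI[of _ h])
      show "h x < n + m" if "x \<in> V" for x
        using f(1)[of x] g(1)[of x] assms(3) that by (cases "x \<in> A") (auto simp: h_def)
      fix x y assume "x \<in> V" "y \<in> V" "E x y"
      then show "h x \<noteq> h y"
        using f(1)[of x] f(1)[of y] f(2)[of x y] g(2)[of x y] assms(3)
        by (cases "x \<in> A"; cases "y \<in> A") (auto simp: h_def)
    qed
  qed
qed

lemma tf_colourable_cover:
  assumes "tf_colourable A E n" "tf_colourable B E m" "V \<subseteq> A \<union> B"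
  shows "tf_colourable V E (n + m)"
  using assms(1)
proof (rule tf_colourableE)
  fix f assume f: "\<And>x. x \<in> A \<Longrightarrow> f x < n"
    "\<And>x y z. x \<in> A \<Longrightarrow> y \<in> A \<Longrightarrow> z \<in> A \<Longrightarrow> E x y \<Longrightarrow> E y z \<Longrightarrow> E x z \<Longrightarrow> f x = f y \<Longrightarrow> f y = f z \<Longrightarrow> False"
  show ?thesis using assms(2)
  proof (rule tf_colourableE)
    fix g assume g: "\<And>x. x \<in> B \<Longrightarrow> g x < m"
      "\<And>x y z. x \<in> B \<Longrightarrow> y \<in> B \<Longrightarrow> z \<in> B \<Longrightarrow> E x y \<Longrightarrow> E y z \<Longrightarrow> E x z \<Longrightarrow> g x = g y \<Longrightarrow> g y = g z \<Longrightarrow> False"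
    define h where "h x = (if x \<in> A then f x else n + g x)" for x
    have hA: "h x < n \<longleftrightarrow> x \<in> A" for x using f(1)[of x] by (auto simp: h_def)
    show ?thesis
    proof (rule tf_colourableI[of _ h])
      show "h x < n + m" if "x \<in> V" for x
        using f(1)[of x] g(1)[of x] assms(3) that by (cases "x \<in> A") (auto simp: h_def)
      fix x y z assume *: "x \<in> V" "y \<in> V" "z \<in> V" "E x y" "E y z" "E x z" "h x = h y" "h y = h z"
      then have "y \<in> A \<longleftrightarrow> x \<in> A" "z \<in> A \<longleftrightarrow> x \<in> A" using hA by metis+
      then show False
        using f(2)[of x y z] g(2)[of x y z] * assms(3) by (cases "x \<in> A") (auto simp: h_def)
    qed
  qed
qed

section \<open>Clean families of rectangles\<close>

definition interval_le :: "('a \<Rightarrow> real) \<Rightarrow> ('a \<Rightarrow> real) \<Rightarrow> 'a \<Rightarrow> 'a \<Rightarrow> bool" where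
  "interval_le l r x y \<longleftrightarrow> l y \<le> l x \<and> r x \<le> r y"

definition interval_meets :: "('a \<Rightarrow> real) \<Rightarrow> ('a \<Rightarrow> real) \<Rightarrow> 'a \<Rightarrow> 'a \<Rightarrow> bool" where
  "interval_meets l r x y \<longleftrightarrow> l x \<le> r y \<and> l y \<le> r x"

definition rect_mem :: "('a \<Rightarrow> real) \<Rightarrow> ('a \<Rightarrow> real) \<Rightarrow> ('a \<Rightarrow> real) \<Rightarrow> ('a \<Rightarrow> real) \<Rightarrow> real \<Rightarrow> real \<Rightarrow> 'a \<Rightarrow> bool" where
  "rect_mem l r b t p q x \<longleftrightarrow> l x \<le> p \<and> p \<le> r x \<and> b x \<le> q \<and> q \<le> t x"

text \<open>Two meeting rectangles cross, or one contains a corner of the other. Crossing is a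
  partial order whose chains have a common point, so \<open>m\<close> colours suffice for it. Each
  of the four corners of a rectangle lies in at most \<open>m\<close> rectangles, so the corner
  relation has outdegree at most \<open>4 * m\<close> and needs \<open>8 * m + 1\<close>
  colours.\<close>

lemma rectangle_intersection_colouring:
  fixes l r b t :: "'i \<Rightarrow> real"
  assumes fin: "finite I"
    and le: "\<And>i. i \<in> I \<Longrightarrow> l i \<le> r i \<and> b i \<le> t i"
    and depth: "\<And>p q. card {i\<in>I. rect_mem l r b t p q i} \<le> m"
  shows "colourable I (\<lambda>i j. i \<noteq> j \<and> interval_meets l r i j \<and> interval_meets b t i j) (m * (8 * m + 1))"
proof -
  define X where "X i j \<longleftrightarrow> l j < l i \<and> r i < r j \<and> b i < b j \<and> t j < t i" for i j
  define D where "D i j \<longleftrightarrow> rect_mem l r b t (l i) (b i) j \<or> rect_mem l r b t (l i) (t i) j \<or>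
    rect_mem l r b t (r i) (b i) j \<or> rect_mem l r b t (r i) (t i) j" for i j
  have X_meet: "l i \<le> r j \<and> b i \<le> t j" if "X i j \<or> X j i" "i \<in> I" "j \<in> I" for i j
    using le[of i] le[of j] that unfolding X_def by linarith
  have "colourable I (\<lambda>i j. X i j \<or> X j i) m"
  proof (rule colourable_heights[OF fin])
    fix K assume K: "K \<subseteq> I" "\<And>x y. x \<in> K \<Longrightarrow> y \<in> K \<Longrightarrow> x \<noteq> y \<Longrightarrow> X x y \<or> X y x"
    have finK: "finite K" using K(1) fin finite_subset by auto
    show "card K \<le> m"
    proof (cases "K = {}")
      case False
      \<comment> \<open>Helly's theorem on each axis: pairwise meeting intervals all contain the
        largest left end.\<close>
      define p where "p = Max (l ` K)"
      define q where "q = Max (b ` K)"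
      have "p \<in> l ` K" "q \<in> b ` K" unfolding p_def q_def using finK False by (auto intro!: Max_in)
      then obtain i j where ij: "i \<in> K" "p = l i" "j \<in> K" "q = b j" by auto
      have "rect_mem l r b t p q k" if k: "k \<in> K" for k
      proof -
        have "l k \<le> p" "b k \<le> q" unfolding p_def q_def using finK k by auto
        moreover have "p \<le> r k" "q \<le> t k"
          using ij K(2)[OF ij(1) k] K(2)[OF ij(3) k] X_meet[of i k] X_meet[of j k] le[of k] k K(1) by auto
        ultimately show ?thesis by (simp add: rect_mem_def)
      qed
      then have "K \<subseteq> {i\<in>I. rect_mem l r b t p q i}" using K(1) by auto
      then have "card K \<le> card {i\<in>I. rect_mem l r b t p q i}" using fin by (intro card_mono) auto
      then show ?thesis using depth[of p q] by linarith
    qed simp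
  qed (auto simp: X_def)
  moreover have "colourable I (\<lambda>i j. i \<noteq> j \<and> (D i j \<or> D j i)) (2 * (4 * m) + 1)"
  proof (rule colourable_outdegree[OF fin])
    fix i
    define P where "P p q = {j\<in>I. rect_mem l r b t p q j}" for p q
    have "{j\<in>I. D i j} = (P (l i) (b i) \<union> P (l i) (t i)) \<union> (P (r i) (b i) \<union> P (r i) (t i))"
      by (auto simp: D_def P_def)
    also have "card \<dots> \<le> (card (P (l i) (b i)) + card (P (l i) (t i))) + (card (P (r i) (b i)) + card (P (r i) (t i)))"
      by (intro order.trans[OF card_Un_le] add_mono card_Un_le)
    also have "\<dots> \<le> (m + m) + (m + m)" unfolding P_def by (intro add_mono depth)
    finally show "card {j\<in>I. D i j} \<le> 4 * m" by simp
  qed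
  ultimately have "colourable I (\<lambda>i j. (X i j \<or> X j i) \<or> (i \<noteq> j \<and> (D i j \<or> D j i))) (m * (2 * (4 * m) + 1))"
    by (rule colourable_Un)
  then show ?thesis
  proof (rule colourable_mono)
    fix i j assume ij: "i \<in> I" "j \<in> I" "i \<noteq> j \<and> interval_meets l r i j \<and> interval_meets b t i j"
    have "X i j \<or> X j i \<or> D i j \<or> D j i"
      using ij(3) le[OF ij(1)] le[OF ij(2)] unfolding X_def D_def rect_mem_def interval_meets_def by (smt (verit))
    then show "(X i j \<or> X j i) \<or> (i \<noteq> j \<and> (D i j \<or> D j i))" using ij by auto
  qed auto
qed

definition rect_sub where "rect_sub l r b t x y \<longleftrightarrow> interval_le l r x y \<and> interval_le b t x y"

definition rect_ov where
  "rect_ov l r b t x y \<longleftrightarrow> interval_meets l r x y \<and> interval_meets b t x y \<and> \<not> rect_sub l r b t x y \<and> \<not> rect_sub l r b t y x"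

definition generic :: "('a \<Rightarrow> real) \<Rightarrow> ('a \<Rightarrow> real) \<Rightarrow> 'a set \<Rightarrow> bool" where
  "generic l r C \<longleftrightarrow> (\<forall>x\<in>C. l x < r x) \<and> (\<forall>x\<in>C. \<forall>y\<in>C. l x \<noteq> r y \<and> r x \<noteq> l y \<and> (x \<noteq> y \<longrightarrow> l x \<noteq> l y \<and> r x \<noteq> r y))"

lemma genD:
  assumes "generic l r C" "x \<in> C"
  shows "l x < r x" "y \<in> C \<Longrightarrow> l x \<noteq> r y" "y \<in> C \<Longrightarrow> r x \<noteq> l y" "y \<in> C \<Longrightarrow> x \<noteq> y \<Longrightarrow> l x \<noteq> l y" 
    "y \<in> C \<Longrightarrow> x \<noteq> y \<Longrightarrow> r x \<noteq> r y"
  using assms unfolding generic_def by blast+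

definition antichain_bound :: "nat \<Rightarrow> nat" where "antichain_bound w = w * (8 * w + 1)"

text \<open>Here \<open>w\<close> only bounds the cliques instead of being the exact clique number,
  so all conditions pass to subfamilies with the same \<open>w\<close>.\<close>

locale clean_family =
  fixes l r b t :: "'a \<Rightarrow> real" and C :: "'a set" and w :: nat
  assumes fin: "finite C"
    and genx: "generic l r C" and geny: "generic b t C"
    and clean: "\<And>x y z. x \<in> C \<Longrightarrow> y \<in> C \<Longrightarrow> z \<in> C \<Longrightarrow> rect_ov l r b t x y \<Longrightarrow> rect_sub l r b t z x \<Longrightarrow> rect_sub l r b t z y \<Longrightarrow> False"
    and noncross: "\<And>x y. x \<in> C \<Longrightarrow> y \<in> C \<Longrightarrow> rect_ov l r b t x y \<Longrightarrow> interval_le l r x y \<Longrightarrow> interval_le b t y x \<Longrightarrow> False"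
    and cliques: "\<And>K. K \<subseteq> C \<Longrightarrow> (\<And>x y. x \<in> K \<Longrightarrow> y \<in> K \<Longrightarrow> x \<noteq> y \<Longrightarrow> rect_ov l r b t x y) \<Longrightarrow> card K \<le> w"

lemma generic_subset: "generic l r C \<Longrightarrow> D \<subseteq> C \<Longrightarrow> generic l r D"
  by (simp add: generic_def subset_iff)

lemma clean_family_subset:
  assumes "clean_family l r b t C w" "D \<subseteq> C"
  shows "clean_family l r b t D w"
proof -
  interpret clean_family l r b t C w by fact
  show ?thesis
  proof
    show "finite D" using assms(2) fin by (rule finite_subset)
    show "generic l r D" "generic b t D" using genx geny assms(2) by (simp_all add: generic_subset)
    show False if "x \<in> D" "y \<in> D" "z \<in> D" "rect_ov l r b t x y" "rect_sub l r b t z x" "rect_sub l r b t z y" for x y z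
      using clean[of x y z] that assms(2) by auto
    show False if "x \<in> D" "y \<in> D" "rect_ov l r b t x y" "interval_le l r x y" "interval_le b t y x" for x y
      using noncross[of x y] that assms(2) by auto
    show "card K \<le> w" if "K \<subseteq> D" "\<And>x y. x \<in> K \<Longrightarrow> y \<in> K \<Longrightarrow> x \<noteq> y \<Longrightarrow> rect_ov l r b t x y" for K
      using that assms(2) by (intro cliques) auto
  qed
qed

section \<open>Mirror images and transposition\<close>

lemma interval_le_reflect [simp]: "interval_le (\<lambda>x. - r x) (\<lambda>x. - l x) x y \<longleftrightarrow> interval_le l r x y"
  by (auto simp: interval_le_def)

lemma interval_meets_reflect [simp]: "interval_meets (\<lambda>x. - r x) (\<lambda>x. - l x) x y \<longleftrightarrow> interval_meets l r x y"
  by (auto simp: interval_meets_def)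

lemma generic_reflect [simp]: "generic (\<lambda>x. - r x) (\<lambda>x. - l x) C \<longleftrightarrow> generic l r C"
  unfolding generic_def neg_less_iff_less neg_equal_iff_equal by blast

lemma rect_sub_reflect [simp]:
  "rect_sub (\<lambda>x. - r x) (\<lambda>x. - l x) b t = rect_sub l r b t" "rect_sub l r (\<lambda>x. - t x) (\<lambda>x. - b x) = rect_sub l r b t"
  by (auto simp: rect_sub_def fun_eq_iff)

lemma rect_ov_reflect [simp]:
  "rect_ov (\<lambda>x. - r x) (\<lambda>x. - l x) b t = rect_ov l r b t" "rect_ov l r (\<lambda>x. - t x) (\<lambda>x. - b x) = rect_ov l r b t"
  by (auto simp: rect_ov_def fun_eq_iff)

lemma rect_sub_transpose: "rect_sub b t l r = rect_sub l r b t"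
  by (auto simp: rect_sub_def fun_eq_iff)

lemma rect_ov_transpose: "rect_ov b t l r = rect_ov l r b t"
  by (auto simp: rect_ov_def rect_sub_def fun_eq_iff)

text \<open>Later arguments treat one side or one corner only; the other cases are the same lemmas
  in a mirrored family, whose notions the simplifier turns back into the original ones.\<close>

lemma clean_family_reflect [simp]:
  "clean_family (\<lambda>x. - r x) (\<lambda>x. - l x) b t C w \<longleftrightarrow> clean_family l r b t C w"
  "clean_family l r (\<lambda>x. - t x) (\<lambda>x. - b x) C w \<longleftrightarrow> clean_family l r b t C w"
  by (simp_all add: clean_family_def)

lemma ov_sym: "rect_ov l r b t x y \<Longrightarrow> rect_ov l r b t y x"
  by (auto simp: rect_ov_def interval_meets_def)

lemma clean_family_transpose:
  assumes "clean_family l r b t C w"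
  shows "clean_family b t l r C w"
proof -
  interpret clean_family l r b t C w by fact
  show ?thesis
  proof (unfold_locales, unfold rect_ov_transpose[of b t l r] rect_sub_transpose[of b t l r])
    show False if "x \<in> C" "y \<in> C" "rect_ov l r b t x y" "interval_le b t x y" "interval_le l r y x" for x y
      using noncross[of y x] that ov_sym[of l r b t x y] by blast
    show "card K \<le> w" if "K \<subseteq> C" "\<And>x y. x \<in> K \<Longrightarrow> y \<in> K \<Longrightarrow> x \<noteq> y \<Longrightarrow> rect_ov l r b t x y" for K
      using that by (rule cliques)
  qed (fact fin genx geny clean)+
qed

text \<open>
  Whatever overlaps a member below \<open>Q\<close> and is not itself below \<open>Q\<close> is contained in a prong.
\<close>

definition prongs_of where
  "prongs_of l r b t C Q =
    {V\<in>C. rect_ov l r b t Q V \<and> (\<forall>y\<in>C. rect_sub l r b t V y \<and> V \<noteq> y \<longrightarrow> rect_sub l r b t Q y)}"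

lemma prongs_of_reflect [simp]:
  "prongs_of (\<lambda>x. - r x) (\<lambda>x. - l x) b t = prongs_of l r b t"
  "prongs_of l r (\<lambda>x. - t x) (\<lambda>x. - b x) = prongs_of l r b t"
  by (simp_all add: prongs_of_def fun_eq_iff)

lemma rect_mem_reflect [simp]:
  "rect_mem (\<lambda>x. - r x) (\<lambda>x. - l x) b t (- p) q x \<longleftrightarrow> rect_mem l r b t p q x"
  "rect_mem l r (\<lambda>x. - t x) (\<lambda>x. - b x) p (- q) x \<longleftrightarrow> rect_mem l r b t p q x"
  by (auto simp: rect_mem_def)

section \<open>The containment forest and the overlaps leaving a subtree\<close>

context clean_family
begin

abbreviation ovl (infix "\<frown>" 50) where "x \<frown> y \<equiv> rect_ov l r b t x y"
abbreviation subs (infix "\<sqsubseteq>" 50) where "x \<sqsubseteq> y \<equiv> rect_sub l r b t x y"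
abbreviation prongs where "prongs \<equiv> prongs_of l r b t C"

lemma lr: "x \<in> C \<Longrightarrow> l x < r x" and bt: "x \<in> C \<Longrightarrow> b x < t x"
  using genD(1) genx geny by metis+

lemma sub_refl: "x \<sqsubseteq> x"
  by (simp add: rect_sub_def interval_le_def)

lemma sub_trans: "x \<sqsubseteq> y \<Longrightarrow> y \<sqsubseteq> z \<Longrightarrow> x \<sqsubseteq> z"
  by (auto simp: rect_sub_def interval_le_def)

lemma sub_antisym: "x \<in> C \<Longrightarrow> y \<in> C \<Longrightarrow> x \<sqsubseteq> y \<Longrightarrow> y \<sqsubseteq> x \<Longrightarrow> x = y"
  using genD(4)[OF genx, of x y] by (auto simp: rect_sub_def interval_le_def)

text \<open>Both rectangles contain \<open>z\<close> and so meet. If they were incomparable they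
  would overlap with \<open>z\<close> in their intersection, which cleanness forbids.\<close>

lemma sub_chain:
  assumes "x \<in> C" "y \<in> C" "z \<in> C" "z \<sqsubseteq> x" "z \<sqsubseteq> y"
  shows "x \<sqsubseteq> y \<or> y \<sqsubseteq> x"
proof -
  have "interval_meets l r x y" "interval_meets b t x y"
    using assms lr[of z] bt[of z] by (auto simp: rect_sub_def interval_le_def interval_meets_def)
  then show ?thesis using clean[of x y z] assms by (auto simp: rect_ov_def)
qed

lemma ov_not_sub: "x \<frown> y \<Longrightarrow> \<not> x \<sqsubseteq> y"
  by (simp add: rect_ov_def)

lemma ov_irrefl: "\<not> x \<frown> x"
  using ov_not_sub sub_refl by blast

lemma ov_up:
  assumes "z \<frown> y" "z \<sqsubseteq> x" "\<not> y \<sqsubseteq> x"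
  shows "x \<frown> y"
  using assms by (auto simp: rect_ov_def rect_sub_def interval_le_def interval_meets_def)

lemma pt_clique:
  assumes "K \<subseteq> C" "\<And>x. x \<in> K \<Longrightarrow> rect_mem l r b t p q x" "\<And>x y. x \<in> K \<Longrightarrow> y \<in> K \<Longrightarrow> x \<sqsubseteq> y \<Longrightarrow> x = y"
  shows "card K \<le> w"
proof (rule cliques)
  fix x y assume "x \<in> K" "y \<in> K" "x \<noteq> y"
  then show "x \<frown> y"
    using assms(2)[of x] assms(2)[of y] assms(3)[of x y] assms(3)[of y x] by (auto simp: rect_ov_def interval_meets_def rect_mem_def)
qed fact

text \<open>On an antichain overlapping is the same as meeting, and the rectangles through one point
  form a clique.\<close>

lemma antichain_colouring:
  assumes "A \<subseteq> C" "\<And>x y. x \<in> A \<Longrightarrow> y \<in> A \<Longrightarrow> x \<sqsubseteq> y \<Longrightarrow> x = y"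
  shows "colourable A (rect_ov l r b t) (antichain_bound w)"
proof -
  have "colourable A (\<lambda>i j. i \<noteq> j \<and> interval_meets l r i j \<and> interval_meets b t i j) (w * (8 * w + 1))"
  proof (rule rectangle_intersection_colouring)
    show "finite A" using assms(1) fin finite_subset by auto
    show "l i \<le> r i \<and> b i \<le> t i" if "i \<in> A" for i using lr[of i] bt[of i] assms(1) that by auto
    show "card {i \<in> A. rect_mem l r b t p q i} \<le> w" for p q
      by (rule pt_clique[of _ p q]) (use assms in auto)
  qed
  then show ?thesis unfolding antichain_bound_def
    by (rule colourable_mono) (use ov_irrefl in \<open>auto simp: rect_ov_def\<close>)
qed

lemma w_pos: "x \<in> C \<Longrightarrow> w > 0"
  using cliques[of "{x}"] by auto

lemma prongsD: "V \<in> prongs Q \<Longrightarrow> V \<in> C" "V \<in> prongs Q \<Longrightarrow> Q \<frown> V"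
  by (auto simp: prongs_of_def)

lemma prongs_antichain:
  assumes "V \<in> prongs Q" "W \<in> prongs Q" "V \<sqsubseteq> W"
  shows "V = W"
  using assms ov_not_sub by (auto simp: prongs_of_def)

lemma exists_maximal:
  assumes "A \<subseteq> C" "A \<noteq> {}"
  obtains m where "m \<in> A" "\<And>y. y \<in> A \<Longrightarrow> m \<sqsubseteq> y \<Longrightarrow> y = m"
proof -
  have "finite A" using assms fin finite_subset by auto
  then have "Min (l ` A) \<in> l ` A" using assms by (intro Min_in) auto
  then obtain m where m: "m \<in> A" "l m = Min (l ` A)" by auto
  have "y = m" if "y \<in> A" "m \<sqsubseteq> y" for y
  proof -
    have "l m \<le> l y" unfolding m(2) using that \<open>finite A\<close> by auto
    moreover have "l y \<le> l m" using that by (auto simp: rect_sub_def interval_le_def)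
    ultimately show ?thesis using genD(4)[OF genx, of m y] m that assms by auto
  qed
  then show thesis using that m by blast
qed

lemma exists_minimal:
  assumes "A \<subseteq> C" "A \<noteq> {}"
  obtains m where "m \<in> A" "\<And>y. y \<in> A \<Longrightarrow> y \<sqsubseteq> m \<Longrightarrow> y = m"
proof -
  have "finite A" using assms fin finite_subset by auto
  then have "Max (l ` A) \<in> l ` A" using assms by (intro Max_in) auto
  then obtain m where m: "m \<in> A" "l m = Max (l ` A)" by auto
  have "y = m" if "y \<in> A" "y \<sqsubseteq> m" for y
  proof -
    have "l y \<le> l m" unfolding m(2) using that \<open>finite A\<close> by auto
    moreover have "l m \<le> l y" using that by (auto simp: rect_sub_def interval_le_def)
    ultimately show ?thesis using genD(4)[OF genx, of m y] m that assms by auto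
  qed
  then show thesis using that m by blast
qed

text \<open>Climb from \<open>v\<close> to a maximal \<open>V\<close> that does not contain
  \<open>Q\<close>. Cleanness keeps \<open>z\<close>, which lies in \<open>Q\<close>, from lying in
  \<open>V\<close> too, so \<open>z\<close> still overlaps \<open>V\<close>.\<close>

lemma exposure_prong:
  assumes "z \<in> C" "Q \<in> C" "v \<in> C" "z \<sqsubseteq> Q" "z \<frown> v" "\<not> v \<sqsubseteq> Q"
  obtains V where "V \<in> prongs Q" "v \<sqsubseteq> V" "z \<frown> V"
proof -
  define A where "A = {y\<in>C. v \<sqsubseteq> y \<and> \<not> Q \<sqsubseteq> y}"
  have "\<not> Q \<sqsubseteq> v" using assms(4,5) sub_trans ov_not_sub by blast
  then have "v \<in> A" using assms(3) sub_refl by (auto simp: A_def)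
  then obtain V where V: "V \<in> A" "\<And>y. y \<in> A \<Longrightarrow> V \<sqsubseteq> y \<Longrightarrow> y = V"
    using exists_maximal[of A] by (auto simp: A_def)
  have VC: "V \<in> C" "v \<sqsubseteq> V" "\<not> Q \<sqsubseteq> V" using V(1) by (auto simp: A_def)
  have "\<not> V \<sqsubseteq> Q" using VC(2) assms(6) sub_trans by blast
  moreover have meet: "interval_meets l r z V" "interval_meets b t z V"
    using assms(5) VC(2) by (auto simp: rect_ov_def rect_sub_def interval_le_def interval_meets_def)
  moreover have "interval_meets l r Q V" "interval_meets b t Q V"
    using meet assms(4) by (auto simp: rect_sub_def interval_le_def interval_meets_def)
  ultimately have QV: "Q \<frown> V" using VC by (simp add: rect_ov_def)
  have "V \<in> prongs Q"
    unfolding prongs_of_def using VC QV V(2) sub_trans[of v V] by (auto simp: A_def)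
  moreover have "z \<frown> V"
    using meet clean[OF assms(2) VC(1) assms(1) QV assms(4)] sub_trans[of V z Q] assms(4) \<open>\<not> V \<sqsubseteq> Q\<close>
    by (auto simp: rect_ov_def)
  ultimately show thesis using that VC(2) by blast
qed

text \<open>The phase colouring of the containment forest. The escaping neighbour \<open>v\<close>
  is replaced by a prong above it, and \<open>H_up\<close> applied on the side of \<open>v\<close>
  makes that prong an \<open>H\<close>-neighbour again.\<close>

lemma phase:
  assumes H_ov: "\<And>x y. x \<in> C \<Longrightarrow> y \<in> C \<Longrightarrow> H x y \<Longrightarrow> x \<frown> y"
    and H_sym: "\<And>x y. x \<in> C \<Longrightarrow> y \<in> C \<Longrightarrow> H x y \<Longrightarrow> H y x"
    and H_up: "\<And>z y x. z \<in> C \<Longrightarrow> y \<in> C \<Longrightarrow> x \<in> C \<Longrightarrow> H z y \<Longrightarrow> z \<sqsubseteq> x \<Longrightarrow> \<not> y \<sqsubseteq> x \<Longrightarrow> H x y"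
  shows "\<exists>f g. (\<forall>x\<in>C. f x < 2 * antichain_bound w) \<and> (\<forall>z\<in>C. \<forall>y\<in>C. H z y \<and> f z = f y \<longrightarrow>
      g z = g y \<and> g z \<in> C \<and> z \<sqsubseteq> g z \<and> (\<exists>V\<in>prongs (g z). H z V))"
proof -
  obtain f g where f: "\<And>x. x \<in> C \<Longrightarrow> f x < 2 * antichain_bound w"
    and g: "\<And>z y. z \<in> C \<Longrightarrow> y \<in> C \<Longrightarrow> H z y \<Longrightarrow> f z = f y \<Longrightarrow>
      g z = g y \<and> g z \<in> C \<and> z \<sqsubseteq> g z \<and> z \<noteq> g z \<and> (\<exists>v\<in>C. H z v \<and> \<not> v \<sqsubseteq> g z)"
  proof (rule phase_colouring[of C "rect_sub l r b t" "rect_ov l r b t" "antichain_bound w" H])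
    show "finite C" by (rule fin)
    show "x \<sqsubseteq> x" for x by (rule sub_refl)
    show "x \<sqsubseteq> z" if "x \<sqsubseteq> y" "y \<sqsubseteq> z" for x y z using that by (rule sub_trans)
    show "x = y" if "x \<in> C" "y \<in> C" "x \<sqsubseteq> y" "y \<sqsubseteq> x" for x y using that by (rule sub_antisym)
    show "x \<sqsubseteq> y \<or> y \<sqsubseteq> x" if "x \<in> C" "y \<in> C" "z \<in> C" "z \<sqsubseteq> x" "z \<sqsubseteq> y" for x y z
      using that by (rule sub_chain)
    show "y \<frown> x" if "x \<frown> y" for x y using that by (rule ov_sym)
    show "\<not> x \<sqsubseteq> y" if "x \<frown> y" for x y using that by (rule ov_not_sub)
    show "x \<frown> y" if "z \<frown> y" "z \<sqsubseteq> x" "\<not> y \<sqsubseteq> x" for x y z using that by (rule ov_up)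
    show "colourable A (rect_ov l r b t) (antichain_bound w)" if "A \<subseteq> C" "\<And>x y. x \<in> A \<Longrightarrow> y \<in> A \<Longrightarrow> x \<sqsubseteq> y \<Longrightarrow> x = y" for A
      using that by (rule antichain_colouring)
    show "x \<frown> y" if "x \<in> C" "y \<in> C" "H x y" for x y using that by (rule H_ov)
    show "H y x" if "x \<in> C" "y \<in> C" "H x y" for x y using that by (rule H_sym)
    show "H x y" if "z \<in> C" "y \<in> C" "x \<in> C" "H z y" "z \<sqsubseteq> x" "\<not> y \<sqsubseteq> x" for x y z
      using that by (rule H_up)
  qed (rule that)
  have "g z = g y \<and> g z \<in> C \<and> z \<sqsubseteq> g z \<and> (\<exists>V\<in>prongs (g z). H z V)"
    if zy: "z \<in> C" "y \<in> C" "H z y" "f z = f y" for z y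
  proof -
    obtain v where v: "v \<in> C" "H z v" "\<not> v \<sqsubseteq> g z" using g[OF zy] by blast
    obtain V where V: "V \<in> prongs (g z)" "v \<sqsubseteq> V" "z \<frown> V"
      using exposure_prong[OF zy(1) _ v(1) _ H_ov[OF zy(1) v(1,2)] v(3)] g[OF zy] by blast
    have "H v z" using H_sym[OF zy(1) v(1,2)] .
    then have "H V z" using H_up[OF v(1) zy(1) prongsD(1)[OF V(1)] _ V(2)] ov_not_sub[OF V(3)] by blast
    then have "H z V" using H_sym[OF prongsD(1)[OF V(1)] zy(1)] by blast
    then show ?thesis using g[OF zy] V(1) by blast
  qed
  with f show ?thesis by (intro exI[of _ f] exI[of _ g]) blast
qed

text \<open>Reduces a global colouring to a local one below each single \<open>Q\<close>: within a
  phase class, both ends of a remaining \<open>H\<close>-pair climb to the same \<open>Q\<close> and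
  are \<open>H\<close>-related to prongs of it.\<close>

lemma phase_colourable:
  assumes H_ov: "\<And>x y. x \<in> C \<Longrightarrow> y \<in> C \<Longrightarrow> H x y \<Longrightarrow> x \<frown> y"
    and H_sym: "\<And>x y. x \<in> C \<Longrightarrow> y \<in> C \<Longrightarrow> H x y \<Longrightarrow> H y x"
    and H_up: "\<And>z y x. z \<in> C \<Longrightarrow> y \<in> C \<Longrightarrow> x \<in> C \<Longrightarrow> H z y \<Longrightarrow> z \<sqsubseteq> x \<Longrightarrow> \<not> y \<sqsubseteq> x \<Longrightarrow> H x y"
    and n: "n > 0"
    and grp: "\<And>Q. Q \<in> C \<Longrightarrow> colourable {z\<in>C. z \<sqsubseteq> Q \<and> (\<exists>V\<in>prongs Q. H z V)} H n"
  shows "colourable C H (2 * antichain_bound w * n)"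
proof -
  obtain f g where f: "\<And>x. x \<in> C \<Longrightarrow> f x < 2 * antichain_bound w"
    and g: "\<And>z y. z \<in> C \<Longrightarrow> y \<in> C \<Longrightarrow> H z y \<Longrightarrow> f z = f y \<Longrightarrow>
      g z = g y \<and> g z \<in> C \<and> z \<sqsubseteq> g z \<and> (\<exists>V\<in>prongs (g z). H z V)"
  proof -
    have "\<exists>f g. (\<forall>x\<in>C. f x < 2 * antichain_bound w) \<and> (\<forall>z\<in>C. \<forall>y\<in>C. H z y \<and> f z = f y \<longrightarrow>
      g z = g y \<and> g z \<in> C \<and> z \<sqsubseteq> g z \<and> (\<exists>V\<in>prongs (g z). H z V))"
      by (rule phase) (use H_ov H_sym H_up in blast)+
    then obtain f g where "(\<forall>x\<in>C. f x < 2 * antichain_bound w) \<and> (\<forall>z\<in>C. \<forall>y\<in>C. H z y \<and> f z = f y \<longrightarrow>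
      g z = g y \<and> g z \<in> C \<and> z \<sqsubseteq> g z \<and> (\<exists>V\<in>prongs (g z). H z V))"
      by (elim exE) (rule that)
    then show thesis by (intro that[of f g]) blast+
  qed
  show ?thesis
  proof (rule colourable_split[OF f])
    fix i
    \<comment> \<open>Members of the phase class outside \<open>A\<close> have no
      \<open>H\<close>-neighbour in that class.\<close>
    define A where "A = {z\<in>C. f z = i \<and> g z \<in> C \<and> z \<sqsubseteq> g z \<and> (\<exists>V\<in>prongs (g z). H z V)}"
    have "colourable A H n"
    proof (rule colourable_groups[of _ _ g])
      fix x y assume "x \<in> A" "y \<in> A" "H x y"
      then show "g x = g y" using g[of x y] by (auto simp: A_def)
    next
      fix Q
      show "colourable {x\<in>A. g x = Q} H n"
      proof (cases "Q \<in> C")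
        case True
        show ?thesis by (rule colourable_mono[OF grp[OF True]]) (auto simp: A_def)
      next
        case False
        have "{x\<in>A. g x = Q} = {}" using False by (auto simp: A_def)
        show ?thesis unfolding \<open>{x\<in>A. g x = Q} = {}\<close> by (simp add: colourable_def)
      qed
    qed
    then show "colourable {x\<in>C. f x = i} H n"
    proof (rule colourable_support[OF _ n])
      fix x y assume "x \<in> {x\<in>C. f x = i}" "y \<in> {x\<in>C. f x = i}" "H x y"
      then show "x \<in> A \<and> y \<in> A"
        using g[of x y] g[of y x] H_sym[of x y] by (auto simp: A_def)
    qed
  qed
qed

lemma phase_tf_colourable:
  assumes n: "n > 0"
    and grp: "\<And>Q. Q \<in> C \<Longrightarrow> tf_colourable {z\<in>C. z \<sqsubseteq> Q \<and> (\<exists>V\<in>prongs Q. z \<frown> V)} (rect_ov l r b t) n"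
  shows "tf_colourable C (rect_ov l r b t) (2 * antichain_bound w * n)"
proof -
  obtain f g where f: "\<And>x. x \<in> C \<Longrightarrow> f x < 2 * antichain_bound w"
    and g: "\<And>z y. z \<in> C \<Longrightarrow> y \<in> C \<Longrightarrow> z \<frown> y \<Longrightarrow> f z = f y \<Longrightarrow>
      g z = g y \<and> g z \<in> C \<and> z \<sqsubseteq> g z \<and> (\<exists>V\<in>prongs (g z). z \<frown> V)"
  proof -
    have "\<exists>f g. (\<forall>x\<in>C. f x < 2 * antichain_bound w) \<and> (\<forall>z\<in>C. \<forall>y\<in>C. z \<frown> y \<and> f z = f y \<longrightarrow>
      g z = g y \<and> g z \<in> C \<and> z \<sqsubseteq> g z \<and> (\<exists>V\<in>prongs (g z). z \<frown> V))"
    proof (rule phase[where H = "rect_ov l r b t"])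
      show "y \<frown> x" if "x \<frown> y" for x y using that by (rule ov_sym)
      show "x \<frown> y" if "z \<frown> y" "z \<sqsubseteq> x" "\<not> y \<sqsubseteq> x" for x y z using that by (rule ov_up)
    qed
    then obtain f g where "(\<forall>x\<in>C. f x < 2 * antichain_bound w) \<and> (\<forall>z\<in>C. \<forall>y\<in>C. z \<frown> y \<and> f z = f y \<longrightarrow>
      g z = g y \<and> g z \<in> C \<and> z \<sqsubseteq> g z \<and> (\<exists>V\<in>prongs (g z). z \<frown> V))"
      by (elim exE) (rule that)
    then show thesis by (intro that[of f g]) blast+
  qed
  define S where "S Q = {z\<in>C. z \<sqsubseteq> Q \<and> (\<exists>V\<in>prongs Q. z \<frown> V)}" for Q
  have "\<exists>h. \<forall>Q. Q \<in> C \<longrightarrow> (\<forall>x\<in>S Q. h Q x < n) \<and> (\<forall>x\<in>S Q. \<forall>y\<in>S Q. \<forall>z\<in>S Q.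
      x \<frown> y \<and> y \<frown> z \<and> x \<frown> z \<longrightarrow> \<not> (h Q x = h Q y \<and> h Q y = h Q z))"
  proof (rule choice, rule allI)
    fix Q
    have "tf_colourable (S Q) (rect_ov l r b t) n" if "Q \<in> C" using grp[OF that] by (simp only: S_def)
    then show "\<exists>h. Q \<in> C \<longrightarrow> (\<forall>x\<in>S Q. h x < n) \<and> (\<forall>x\<in>S Q. \<forall>y\<in>S Q. \<forall>z\<in>S Q.
      x \<frown> y \<and> y \<frown> z \<and> x \<frown> z \<longrightarrow> \<not> (h x = h y \<and> h y = h z))"
      unfolding tf_colourable_def by (cases "Q \<in> C") simp_all
  qed
  then obtain h where h: "\<forall>Q. Q \<in> C \<longrightarrow> (\<forall>x\<in>S Q. h Q x < n) \<and> (\<forall>x\<in>S Q. \<forall>y\<in>S Q. \<forall>z\<in>S Q.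
      x \<frown> y \<and> y \<frown> z \<and> x \<frown> z \<longrightarrow> \<not> (h Q x = h Q y \<and> h Q y = h Q z))" by (elim exE) (rule that)
  \<comment> \<open>The default 0 is taken only by vertices without a neighbour in their phase
    class. The vertices of a triangle inside a class all lie in one common
    \<open>S Q\<close>.\<close>
  define k where "k x = (if g x \<in> C \<and> x \<in> S (g x) then h (g x) x else 0)" for x
  have k: "k x < n" for x using h n by (auto simp: k_def)
  show ?thesis
  proof (rule tf_colourableI[where f = "\<lambda>x. f x * n + k x"])
    show "f x * n + k x < 2 * antichain_bound w * n" if "x \<in> C" for x using f k that by (intro pair_code_less)
    fix x y z assume *: "x \<in> C" "y \<in> C" "z \<in> C" and xyz: "x \<frown> y" "y \<frown> z" "x \<frown> z"
      and eq: "f x * n + k x = f y * n + k y" "f y * n + k y = f z * n + k z"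
    have fk: "f x = f y \<and> k x = k y" "f y = f z \<and> k y = k z"
      using pair_code_inj[OF eq(1) k k] pair_code_inj[OF eq(2) k k] by auto
    have "f y = f x" "f z = f y" "z \<frown> y" using fk ov_sym[OF xyz(2)] by auto
    then have G: "g x = g y \<and> g x \<in> C \<and> x \<sqsubseteq> g x \<and> (\<exists>V\<in>prongs (g x). x \<frown> V)"
      "g y = g z \<and> g y \<in> C \<and> y \<sqsubseteq> g y \<and> (\<exists>V\<in>prongs (g y). y \<frown> V)"
      "g z = g y \<and> g z \<in> C \<and> z \<sqsubseteq> g z \<and> (\<exists>V\<in>prongs (g z). z \<frown> V)"
      by - (rule g[OF *(1,2) xyz(1)], simp, rule g[OF *(2,3) xyz(2)], simp, rule g[OF *(3,2)], simp, simp)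
    define Q where "Q = g x"
    have gQ: "g x = Q" "g y = Q" "g z = Q" using G(1,2) unfolding Q_def by metis+
    have Q: "Q \<in> C" "x \<in> S Q" "y \<in> S Q" "z \<in> S Q" using G[unfolded gQ] * unfolding S_def by blast+
    have "k x = h Q x" "k y = h Q y" "k z = h Q z" using gQ Q by (simp_all add: k_def)
    then have "h Q x = h Q y" "h Q y = h Q z" using fk by simp_all
    moreover have "\<forall>x\<in>S Q. \<forall>y\<in>S Q. \<forall>z\<in>S Q.
      x \<frown> y \<and> y \<frown> z \<and> x \<frown> z \<longrightarrow> \<not> (h Q x = h Q y \<and> h Q y = h Q z)"
      using h Q(1) by (elim allE impE conjE)
    ultimately show False using Q(2-4) xyz by blast
  qed
qed

end

section \<open>Rectangles meeting a common line\<close>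

text \<open>The factor \<open>w * w\<close> removes nested x-intervals, once for each vertical
  direction of shift; the other factor is the phase colouring, with \<open>w\<close> colours for
  right and \<open>w\<close> for left prongs.\<close>

definition line_bound :: "nat \<Rightarrow> nat" where
  "line_bound w = (w * w) * (2 * antichain_bound w * (w + w))"

context clean_family
begin

text \<open>Otherwise \<open>z\<close> starts to the right of \<open>x\<close>, hence after
  \<open>V\<close> starts, and it ends with \<open>Q\<close> at the latest, hence before
  \<open>V\<close> ends. By cleanness \<open>z\<close> is not inside \<open>V\<close>, so the two
  overlap with nested x-intervals.\<close>

lemma right_prong_reach:
  assumes nonest: "\<And>x y. x \<in> C \<Longrightarrow> y \<in> C \<Longrightarrow> x \<frown> y \<Longrightarrow> \<not> interval_le l r x y"
    and C: "Q \<in> C" "z \<in> C" and z: "z \<sqsubseteq> Q"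
    and V: "V \<in> prongs Q" "x \<frown> V" "r Q < r V" "interval_meets b t z V"
  shows "l z \<le> r x"
proof (rule ccontr)
  note VC = prongsD[OF V(1)]
  assume "\<not> l z \<le> r x"
  moreover have "l V \<le> r x" using V(2) by (auto simp: rect_ov_def interval_meets_def)
  ultimately have n: "interval_le l r z V" using z V(3) by (auto simp: interval_le_def rect_sub_def)
  have "\<not> z \<sqsubseteq> V" using clean[OF C(1) VC(1) C(2) VC(2) z] by blast
  moreover have "\<not> V \<sqsubseteq> z" using z V(3) by (auto simp: interval_le_def rect_sub_def)
  moreover have "interval_meets l r z V" using n lr[OF C(2)] by (auto simp: interval_le_def interval_meets_def)
  ultimately have "z \<frown> V" using V(4) by (simp add: rect_ov_def)
  then show False using nonest[OF C(2) VC(1)] n by blast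
qed

text \<open>Overlaps oriented from left to right are transitive here: the prong met by the first
  rectangle forces the third to reach back to the first, and the common line makes them meet
  vertically.\<close>

lemma right_prong_colouring:
  assumes nonest: "\<And>x y. x \<in> C \<Longrightarrow> y \<in> C \<Longrightarrow> x \<frown> y \<Longrightarrow> \<not> interval_le l r x y"
    and line: "\<And>x. x \<in> C \<Longrightarrow> b x \<le> y0 \<and> y0 \<le> t x"
    and Q: "Q \<in> C"
  shows "colourable {z\<in>C. z \<sqsubseteq> Q \<and> (\<exists>V\<in>prongs Q. z \<frown> V \<and> r Q < r V)} (rect_ov l r b t) w"
proof -
  define G where "G = {z\<in>C. z \<sqsubseteq> Q \<and> (\<exists>V\<in>prongs Q. z \<frown> V \<and> r Q < r V)}"
  have GC: "G \<subseteq> C" by (auto simp: G_def)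
  define R where "R x y \<longleftrightarrow> x \<frown> y \<and> l x < l y" for x y
  have R: "r x < r y" if "R x y" "x \<in> C" "y \<in> C" for x y
    using that nonest[of y x] ov_sym[of l r b t x y] by (auto simp: R_def interval_le_def)
  have vert: "interval_meets b t x y" if "x \<in> C" "y \<in> C" for x y
    using line[OF that(1)] line[OF that(2)] by (auto simp: interval_meets_def)
  have "colourable G (\<lambda>x y. R x y \<or> R y x) w"
  proof (rule colourable_heights)
    show "finite G" using GC fin by (rule finite_subset)
    show "\<not> R x x" for x using ov_irrefl by (auto simp: R_def)
    show "card K \<le> w" if "K \<subseteq> G" "\<And>x y. x \<in> K \<Longrightarrow> y \<in> K \<Longrightarrow> x \<noteq> y \<Longrightarrow> R x y \<or> R y x" for K
      by (rule cliques) (use that GC in \<open>auto simp: R_def dest: ov_sym\<close>)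
    fix x y z assume *: "x \<in> G" "y \<in> G" "z \<in> G" "R x y" "R y z"
    then have C: "x \<in> C" "y \<in> C" "z \<in> C" using GC by auto
    have lt: "l x < l y" "l y < l z" "r x < r y" "r y < r z" using * C R by (auto simp: R_def)
    obtain V where V: "V \<in> prongs Q" "x \<frown> V" "r Q < r V" using *(1) unfolding G_def by blast
    note VC = prongsD[OF V(1)]
    have xz: "x \<sqsubseteq> Q" "z \<sqsubseteq> Q" using *(1,3) by (auto simp: G_def)
    have "l z \<le> r x"
      using nonest Q C(3) xz(2) V vert[OF C(3) VC(1)] by (rule right_prong_reach)
    then have "x \<frown> z"
      using vert[OF C(1,3)] lt lr[OF C(1)] lr[OF C(3)] by (auto simp: rect_ov_def interval_meets_def rect_sub_def interval_le_def)
    then show "R x z" using lt by (simp add: R_def)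
  qed
  then have "colourable G (rect_ov l r b t) w"
  proof (rule colourable_mono)
    fix x y assume "x \<in> G" "y \<in> G" and xy: "x \<frown> y"
    then have C: "x \<in> C" "y \<in> C" using GC by auto
    have "x \<noteq> y" using xy ov_irrefl by blast
    then have "l x \<noteq> l y" using genD(4)[OF genx C(1,2)] by blast
    then show "R x y \<or> R y x" using xy ov_sym[OF xy] unfolding R_def by linarith
  qed auto
  then show ?thesis by (simp only: G_def)
qed

end

text \<open>Without nested x-intervals each prong sticks out of \<open>Q\<close> on the right or on
  the left; the left case is a mirror image.\<close>

lemma (in clean_family) line_colouring_nonest:
  assumes nonest: "\<And>x y. x \<in> C \<Longrightarrow> y \<in> C \<Longrightarrow> x \<frown> y \<Longrightarrow> \<not> interval_le l r x y"
    and line: "\<And>x. x \<in> C \<Longrightarrow> b x \<le> y0 \<and> y0 \<le> t x"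
  shows "colourable C (rect_ov l r b t) (2 * antichain_bound w * (w + w))"
proof (cases "C = {}")
  case False
  then have "w > 0" using w_pos by blast
  then have n: "w + w > 0" by simp
  have refl: "clean_family (\<lambda>x. - r x) (\<lambda>x. - l x) b t C w"
    using clean_family_axioms by simp
  show ?thesis
  proof (rule phase_colourable[OF _ _ _ n])
    show "y \<frown> x" if "x \<frown> y" for x y using that by (rule ov_sym)
    show "x \<frown> y" if "z \<frown> y" "z \<sqsubseteq> x" "\<not> y \<sqsubseteq> x" for x y z using that by (rule ov_up)
    fix Q assume Q: "Q \<in> C"
    have right: "colourable {z\<in>C. z \<sqsubseteq> Q \<and> (\<exists>V\<in>prongs Q. z \<frown> V \<and> r Q < r V)} (rect_ov l r b t) w"
      using nonest line Q by (rule right_prong_colouring)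
    have left: "colourable {z\<in>C. z \<sqsubseteq> Q \<and> (\<exists>V\<in>prongs Q. z \<frown> V \<and> l V < l Q)} (rect_ov l r b t) w"
      using clean_family.right_prong_colouring[OF refl _ line Q] nonest by simp
    from right left show "colourable {z\<in>C. z \<sqsubseteq> Q \<and> (\<exists>V\<in>prongs Q. z \<frown> V)} (rect_ov l r b t) (w + w)"
    proof (rule colourable_cover)
      have "r Q < r V \<or> l V < l Q" if "V \<in> prongs Q" for V
        using nonest[OF prongsD(1)[OF that] Q] ov_sym[OF prongsD(2)[OF that]] by (auto simp: interval_le_def)
      then show "{z\<in>C. z \<sqsubseteq> Q \<and> (\<exists>V\<in>prongs Q. z \<frown> V)} \<subseteq>
          {z\<in>C. z \<sqsubseteq> Q \<and> (\<exists>V\<in>prongs Q. z \<frown> V \<and> r Q < r V)} \<union>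
          {z\<in>C. z \<sqsubseteq> Q \<and> (\<exists>V\<in>prongs Q. z \<frown> V \<and> l V < l Q)}" by blast
    qed
  qed
qed (simp add: colourable_def)

text \<open>Inclusion of x-intervals and downward shifts compose, and the common line keeps the
  outer two rectangles meeting. So \<open>R\<close> is transitive.\<close>

lemma (in clean_family) top_overlap_colouring:
  assumes line: "\<And>x. x \<in> C \<Longrightarrow> b x \<le> y0 \<and> y0 \<le> t x"
  defines "R x y \<equiv> x \<frown> y \<and> interval_le l r x y \<and> b y < b x \<and> t y < t x"
  shows "colourable C (\<lambda>x y. R x y \<or> R y x) w"
proof (rule colourable_heights[OF fin])
  show "\<not> R x x" for x using ov_irrefl by (auto simp: R_def)
  show "card K \<le> w" if "K \<subseteq> C" "\<And>x y. x \<in> K \<Longrightarrow> y \<in> K \<Longrightarrow> x \<noteq> y \<Longrightarrow> R x y \<or> R y x" for K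
    by (rule cliques) (use that in \<open>auto simp: R_def dest: ov_sym\<close>)
  fix x y z assume C: "x \<in> C" "y \<in> C" "z \<in> C" and R: "R x y" "R y z"
  have n: "interval_le l r x z" "b z < b x" "t z < t x" using R by (auto simp: R_def interval_le_def)
  then have "interval_meets l r x z" "interval_meets b t x z" "\<not> x \<sqsubseteq> z"
    using lr[OF C(1)] lr[OF C(3)] line[OF C(1)] line[OF C(3)] by (auto simp: interval_meets_def interval_le_def rect_sub_def)
  moreover have "\<not> z \<sqsubseteq> x" using n by (auto simp: interval_le_def rect_sub_def)
  ultimately show "R x z" using n by (simp add: R_def rect_ov_def)
qed

lemma (in clean_family) line_colouring:
  assumes line: "\<And>x. x \<in> C \<Longrightarrow> b x \<le> y0 \<and> y0 \<le> t x"
  shows "colourable C (rect_ov l r b t) (line_bound w)"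
proof -
  define T where "T x y \<longleftrightarrow> x \<frown> y \<and> interval_le l r x y \<and> b y < b x \<and> t y < t x" for x y
  define B where "B x y \<longleftrightarrow> x \<frown> y \<and> interval_le l r x y \<and> t x < t y \<and> b x < b y" for x y
  have refl: "clean_family l r (\<lambda>x. - t x) (\<lambda>x. - b x) C w"
    using clean_family_axioms by simp
  have "colourable C (\<lambda>x y. T x y \<or> T y x) w"
    using top_overlap_colouring[OF line] by (simp add: T_def)
  moreover have "colourable C (\<lambda>x y. B x y \<or> B y x) w"
    using clean_family.top_overlap_colouring[OF refl, of "- y0"] line by (simp add: B_def)
  ultimately have "colourable C (\<lambda>x y. (T x y \<or> T y x) \<or> (B x y \<or> B y x)) (w * w)" by (rule colourable_Un)
  then show ?thesis unfolding line_bound_def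
  proof (rule colourable_classes)
    fix D assume D: "D \<subseteq> C" "\<And>x y. x \<in> D \<Longrightarrow> y \<in> D \<Longrightarrow> \<not> ((T x y \<or> T y x) \<or> (B x y \<or> B y x))"
    have cfD: "clean_family l r b t D w" using clean_family_axioms D(1) by (rule clean_family_subset)
    show "colourable D (rect_ov l r b t) (2 * antichain_bound w * (w + w))"
    proof (rule clean_family.line_colouring_nonest[OF cfD])
      show "b x \<le> y0 \<and> y0 \<le> t x" if "x \<in> D" for x using line that D(1) by blast
      show "\<not> interval_le l r x y" if "x \<in> D" "y \<in> D" "x \<frown> y" for x y
      proof
        assume n: "interval_le l r x y"
        \<comment> \<open>With nested x-intervals, excluding crossing and containment leaves only a
          vertical shift, which is \<open>T\<close> or \<open>B\<close>.\<close>
        have "\<not> interval_le b t y x" using noncross[of x y] that D(1) n by blast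
        moreover have "\<not> interval_le b t x y" using that(3) n by (simp add: rect_ov_def rect_sub_def)
        ultimately have "(b y < b x \<and> t y < t x) \<or> (t x < t y \<and> b x < b y)"
          unfolding interval_le_def by linarith
        then show False using D(2)[OF that(1,2)] that(3) n by (auto simp: T_def B_def)
      qed
    qed
  qed
qed

section \<open>Corners in intersections of overlapping rectangles\<close>

text \<open>The selectors \<open>X\<close> and \<open>Y\<close> name the corner, so that one
  definition covers all four; the same corner is taken in \<open>x\<close> and in
  \<open>y\<close>.\<close>

definition corner_clash where
  "corner_clash X Y l r b t C x y \<longleftrightarrow> rect_ov l r b t x y \<and> (\<exists>p\<in>C. \<exists>s\<in>C. rect_ov l r b t p s \<and>
     rect_mem l r b t (X x) (Y x) p \<and> rect_mem l r b t (X x) (Y x) s \<and> rect_mem l r b t (X y) (Y y) p \<and> rect_mem l r b t (X y) (Y y) s)"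

lemma corner_clash_reflect:
  "corner_clash (\<lambda>x. - X x) Y (\<lambda>x. - r x) (\<lambda>x. - l x) b t C = corner_clash X Y l r b t C"
  "corner_clash X (\<lambda>x. - Y x) l r (\<lambda>x. - t x) (\<lambda>x. - b x) C = corner_clash X Y l r b t C"
  by (simp_all add: corner_clash_def fun_eq_iff)

text \<open>
  The maximal overlapping pairs; by cleanness every point lies in boundedly many of the
  intersections of such pairs, and those intersections contain all others.
\<close>

definition siblings where
  "siblings l r b t C = {(u, v). u \<in> C \<and> v \<in> C \<and> rect_ov l r b t u v \<and>
     (\<forall>y\<in>C. rect_sub l r b t u y \<and> u \<noteq> y \<longrightarrow> rect_sub l r b t v y) \<and>
     (\<forall>y\<in>C. rect_sub l r b t v y \<and> v \<noteq> y \<longrightarrow> rect_sub l r b t u y)}"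

context clean_family
begin

abbreviation "sibs \<equiv> siblings l r b t C"

text \<open>Take \<open>u\<close> maximal above \<open>p\<close> without containing
  \<open>s\<close>, then \<open>v\<close> maximal above \<open>s\<close> without containing this
  \<open>u\<close>. A strict container of \<open>u\<close> contains \<open>s\<close>, is therefore
  comparable with \<open>v\<close>, and can only contain it.\<close>

lemma sibs_above:
  assumes "p \<in> C" "s \<in> C" "p \<frown> s"
  obtains u v where "(u, v) \<in> sibs" "p \<sqsubseteq> u" "s \<sqsubseteq> v"
proof -
  define A where "A = {y\<in>C. p \<sqsubseteq> y \<and> \<not> s \<sqsubseteq> y}"
  have "\<not> s \<sqsubseteq> p" using ov_not_sub[OF ov_sym[OF assms(3)]] .
  then have "p \<in> A" using assms(1) sub_refl by (simp add: A_def)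
  then obtain u where u: "u \<in> A" "\<And>y. y \<in> A \<Longrightarrow> u \<sqsubseteq> y \<Longrightarrow> y = u"
    using exists_maximal[of A] by (auto simp: A_def)
  have uC: "u \<in> C" "p \<sqsubseteq> u" "\<not> s \<sqsubseteq> u" using u(1) by (auto simp: A_def)
  define B where "B = {y\<in>C. s \<sqsubseteq> y \<and> \<not> u \<sqsubseteq> y}"
  have "\<not> u \<sqsubseteq> s" using sub_trans[OF uC(2)] ov_not_sub[OF assms(3)] by blast
  then have "s \<in> B" using assms(2) sub_refl by (simp add: B_def)
  then obtain v where v: "v \<in> B" "\<And>y. y \<in> B \<Longrightarrow> v \<sqsubseteq> y \<Longrightarrow> y = v"
    using exists_maximal[of B] by (auto simp: B_def)
  have vC: "v \<in> C" "s \<sqsubseteq> v" "\<not> u \<sqsubseteq> v" using v(1) by (auto simp: B_def)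
  have "u \<frown> s" using ov_up[OF assms(3) uC(2,3)] .
  then have "v \<frown> u" using ov_up[OF ov_sym vC(2,3)] by blast
  then have uv: "u \<frown> v" by (rule ov_sym)
  have 1: "v \<sqsubseteq> y" if y: "y \<in> C" "u \<sqsubseteq> y" "u \<noteq> y" for y
  proof -
    have "y \<notin> A" using u(2) y by blast
    then have "s \<sqsubseteq> y" using y sub_trans[OF uC(2)] by (simp add: A_def)
    then have "v \<sqsubseteq> y \<or> y \<sqsubseteq> v" using sub_chain[OF vC(1) y(1) assms(2) vC(2)] by blast
    then show ?thesis using sub_trans[OF y(2)] vC(3) by blast
  qed
  have 2: "u \<sqsubseteq> y" if y: "y \<in> C" "v \<sqsubseteq> y" "v \<noteq> y" for y
  proof -
    have "y \<notin> B" using v(2) y by blast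
    then show ?thesis using y sub_trans[OF vC(2)] by (simp add: B_def)
  qed
  have "(u, v) \<in> sibs" unfolding siblings_def using uC vC uv 1 2 by simp
  then show thesis using that uC vC by blast
qed

text \<open>Below each of \<open>u\<close> and \<open>v\<close> choose a minimal rectangle through
  the point. These minimal rectangles form an antichain through a point, so there are at most
  \<open>w\<close>, and the map on pairs is injective.\<close>

lemma sibs_depth:
  "card {(u, v). (u, v) \<in> sibs \<and> rect_mem l r b t p q u \<and> rect_mem l r b t p q v} \<le> w * w"
proof -
  define S where "S = {(u, v). (u, v) \<in> sibs \<and> rect_mem l r b t p q u \<and> rect_mem l r b t p q v}"
  define P where "P = {x\<in>C. rect_mem l r b t p q x}"
  define M where "M = {x\<in>P. \<forall>y\<in>P. y \<sqsubseteq> x \<longrightarrow> y = x}"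
  have "card M \<le> w" by (rule pt_clique[of _ p q]) (auto simp: M_def P_def)
  have finM: "finite M" using fin by (simp add: M_def P_def)
  have "\<exists>m. m \<in> M \<and> m \<sqsubseteq> u" if u: "u \<in> P" for u
  proof -
    define A where "A = {x\<in>P. x \<sqsubseteq> u}"
    have "u \<in> A" using u sub_refl by (simp add: A_def)
    moreover have AC: "A \<subseteq> C" by (auto simp: A_def P_def)
    ultimately obtain m where m: "m \<in> A" "\<And>y. y \<in> A \<Longrightarrow> y \<sqsubseteq> m \<Longrightarrow> y = m"
      using exists_minimal[of A] by blast
    have "y = m" if "y \<in> P" "y \<sqsubseteq> m" for y
    proof (rule m(2))
      have "m \<sqsubseteq> u" using m(1) by (simp add: A_def)
      then show "y \<in> A" using that sub_trans[of y m u] by (simp add: A_def)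
    qed fact
    then show ?thesis using m(1) by (intro exI[of _ m]) (simp add: M_def A_def)
  qed
  then have "\<forall>u\<in>P. \<exists>m. m \<in> M \<and> m \<sqsubseteq> u" by simp
  from bchoice[OF this] obtain m where m: "\<forall>u\<in>P. m u \<in> M \<and> m u \<sqsubseteq> u" by (elim exE) (rule that)
  have MC: "x \<in> C" if "x \<in> M" for x using that by (simp add: M_def P_def)
  have SD: "u \<in> C" "v \<in> C" "u \<in> P" "v \<in> P" "u \<frown> v" "m u \<in> C" "m v \<in> C" "m u \<sqsubseteq> u" "m v \<sqsubseteq> v"
    "\<And>y. y \<in> C \<Longrightarrow> u \<sqsubseteq> y \<Longrightarrow> u \<noteq> y \<Longrightarrow> v \<sqsubseteq> y" "\<And>y. y \<in> C \<Longrightarrow> v \<sqsubseteq> y \<Longrightarrow> v \<noteq> y \<Longrightarrow> u \<sqsubseteq> y"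
    if "(u, v) \<in> S" for u v
  proof -
    show "u \<in> C" "v \<in> C" "u \<in> P" "v \<in> P" "u \<frown> v" using that by (simp_all add: S_def siblings_def P_def)
    then show "m u \<in> C" "m v \<in> C" "m u \<sqsubseteq> u" "m v \<sqsubseteq> v" using m MC by simp_all
    show "v \<sqsubseteq> y" if "y \<in> C" "u \<sqsubseteq> y" "u \<noteq> y" for y using that \<open>(u, v) \<in> S\<close> by (simp add: S_def siblings_def)
    show "u \<sqsubseteq> y" if "y \<in> C" "v \<sqsubseteq> y" "v \<noteq> y" for y using that \<open>(u, v) \<in> S\<close> by (simp add: S_def siblings_def)
  qed
  \<comment> \<open>If \<open>u\<close> were strictly inside \<open>u'\<close>, then
    \<open>v\<close>, and with it \<open>m v\<close>, would lie in \<open>u'\<close>. As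
    \<open>m v = m v'\<close> also lies in \<open>v'\<close>, this contradicts cleanness.\<close>
  have nu: "\<not> (u \<sqsubseteq> u' \<and> u \<noteq> u')" if "(u, v) \<in> S" "(u', v') \<in> S" "m v = m v'" for u v u' v'
  proof
    assume "u \<sqsubseteq> u' \<and> u \<noteq> u'"
    then have "v \<sqsubseteq> u'" using SD(10)[OF that(1) SD(1)[OF that(2)]] by blast
    then have "m v \<sqsubseteq> u'" using sub_trans[OF SD(9)[OF that(1)]] by blast
    moreover have "m v \<sqsubseteq> v'" using SD(9)[OF that(2)] that(3) by simp
    ultimately show False
      using clean[OF SD(1)[OF that(2)] SD(2)[OF that(2)] SD(7)[OF that(1)] SD(5)[OF that(2)]] by blast
  qed
  have nv: "\<not> (v \<sqsubseteq> v' \<and> v \<noteq> v')" if "(u, v) \<in> S" "(u', v') \<in> S" "m u = m u'" for u v u' v'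
  proof
    assume "v \<sqsubseteq> v' \<and> v \<noteq> v'"
    then have "u \<sqsubseteq> v'" using SD(11)[OF that(1) SD(2)[OF that(2)]] by blast
    then have "m u \<sqsubseteq> v'" using sub_trans[OF SD(8)[OF that(1)]] by blast
    moreover have "m u \<sqsubseteq> u'" using SD(8)[OF that(2)] that(3) by simp
    ultimately show False
      using clean[OF SD(1)[OF that(2)] SD(2)[OF that(2)] SD(6)[OF that(1)] SD(5)[OF that(2)]] by blast
  qed
  have "inj_on (map_prod m m) S"
  proof (rule inj_onI)
    fix i j assume ij: "i \<in> S" "j \<in> S" "map_prod m m i = map_prod m m j"
    obtain u v where i: "i = (u, v)" by (cases i)
    obtain u' v' where j: "j = (u', v')" by (cases j)
    have S: "(u, v) \<in> S" "(u', v') \<in> S" using ij i j by simp_all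
    have m: "m u = m u'" "m v = m v'" using ij(3) i j by simp_all
    have "u \<sqsubseteq> u' \<or> u' \<sqsubseteq> u"
      using sub_chain[OF SD(1)[OF S(1)] SD(1)[OF S(2)] SD(6)[OF S(1)] SD(8)[OF S(1)]] SD(8)[OF S(2)] m by simp
    then have "u = u'" using nu[OF S m(2)] nu[OF S(2,1) m(2)[symmetric]] by blast
    moreover have "v \<sqsubseteq> v' \<or> v' \<sqsubseteq> v"
      using sub_chain[OF SD(2)[OF S(1)] SD(2)[OF S(2)] SD(7)[OF S(1)] SD(9)[OF S(1)]] SD(9)[OF S(2)] m by simp
    then have "v = v'" using nv[OF S m(1)] nv[OF S(2,1) m(1)[symmetric]] by blast
    ultimately show "i = j" using i j by simp
  qed
  moreover have "map_prod m m ` S \<subseteq> M \<times> M" using m SD(3,4) by auto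
  ultimately have "card S \<le> card (M \<times> M)" using finM by (intro card_inj_on_le) auto
  also have "\<dots> \<le> w * w" using \<open>card M \<le> w\<close> by (simp add: card_cartesian_product mult_le_mono)
  finally show ?thesis by (simp only: S_def)
qed

end

text \<open>The exponent counts the colours of the sibling intersections, of which at most
  \<open>w * w\<close> contain any given point; each colour contributes one factor.\<close>

definition corner_bound :: "nat \<Rightarrow> nat" where
  "corner_bound w = (2 * line_bound w) ^ antichain_bound (w * w)"

text \<open>By cleanness a rectangle with its bottom left corner in the intersection of
  \<open>u\<close> and \<open>v\<close> is not contained in it. So it reaches the line through the
  right side or the line through the top side of the intersection.\<close>

lemma (in clean_family) sib_region_colouring:
  assumes "u \<in> C" "v \<in> C" "u \<frown> v"
  shows "colourable {x\<in>C. rect_mem l r b t (l x) (b x) u \<and> rect_mem l r b t (l x) (b x) v} (rect_ov l r b t) (2 * line_bound w)"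
proof (rule colourable_split[where f = "\<lambda>x. if min (r u) (r v) \<le> r x then 0 else 1"])
  define A where "A = {x\<in>C. rect_mem l r b t (l x) (b x) u \<and> rect_mem l r b t (l x) (b x) v}"
  have AC: "A \<subseteq> C" by (auto simp: A_def)
  fix i :: nat assume "i < 2"
  then consider "i = 0" | "i = 1" by linarith
  then have "colourable {x\<in>A. (if min (r u) (r v) \<le> r x then 0 else 1) = i} (rect_ov l r b t) (line_bound w)"
  proof cases
    case 1
    let ?D = "{x\<in>A. (if min (r u) (r v) \<le> r x then 0 else 1) = i}"
    have cfD: "clean_family b t l r ?D w"
      by (rule clean_family_transpose, rule clean_family_subset[OF clean_family_axioms]) (use AC in auto)
    have "colourable ?D (rect_ov b t l r) (line_bound w)"
      by (rule clean_family.line_colouring[OF cfD, of "min (r u) (r v)"])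
        (use 1 in \<open>auto simp: A_def rect_mem_def split: if_splits\<close>)
    then show ?thesis by (simp only: rect_ov_transpose[of b t l r])
  next
    case 2
    let ?D = "{x\<in>A. (if min (r u) (r v) \<le> r x then 0 else 1) = i}"
    have cfD: "clean_family l r b t ?D w"
      by (rule clean_family_subset[OF clean_family_axioms]) (use AC in auto)
    show ?thesis
    proof (rule clean_family.line_colouring[OF cfD, of "min (t u) (t v)"])
      fix x assume x: "x \<in> ?D"
      then have xC: "x \<in> C" using AC by auto
      have "x \<in> A" "(if min (r u) (r v) \<le> r x then 0 else 1 :: nat) = 1" using x 2 by simp_all
      then have "x \<in> A" "\<not> min (r u) (r v) \<le> r x" by presburger+
      then have r: "r x < r u" "r x < r v" and p: "rect_mem l r b t (l x) (b x) u" "rect_mem l r b t (l x) (b x) v"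
        by (simp_all add: A_def)
      have "min (t u) (t v) \<le> t x"
      proof (rule ccontr)
        assume "\<not> ?thesis"
        then have "t x < t u" "t x < t v" by auto
        then have "x \<sqsubseteq> u" "x \<sqsubseteq> v" using r p by (auto simp: rect_sub_def interval_le_def rect_mem_def)
        then show False using clean[OF assms(1,2) xC assms(3)] by blast
      qed
      then show "b x \<le> min (t u) (t v) \<and> min (t u) (t v) \<le> t x" using p by (auto simp: rect_mem_def)
    qed
  qed
  then show "colourable {x \<in> {x \<in> C. rect_mem l r b t (l x) (b x) u \<and> rect_mem l r b t (l x) (b x) v}.
           (if min (r u) (r v) \<le> r x then 0 else 1) = i} (rect_ov l r b t) (line_bound w)"
    by (simp only: A_def)
qed simp

text \<open>Colour the sibling intersections so that meeting ones differ. Then a corner lies in at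
  most one intersection of each colour \<open>k\<close>, so for fixed \<open>k\<close> the regions
  are independent groups. Every clash happens inside some sibling intersection, and the colourings
  for all \<open>k\<close> are multiplied.\<close>

lemma (in clean_family) corner_clash_colouring:
  "colourable C (corner_clash l b l r b t C) (corner_bound w)"
proof (cases "C = {}")
  case False
  then have w: "w > 0" using w_pos by blast
  then have n: "2 * line_bound w > 0" by (simp add: line_bound_def antichain_bound_def)
  define L where "L i = max (l (fst i)) (l (snd i))" for i
  define R where "R i = min (r (fst i)) (r (snd i))" for i
  define B where "B i = max (b (fst i)) (b (snd i))" for i
  define T where "T i = min (t (fst i)) (t (snd i))" for i
  have sibsC: "sibs \<subseteq> C \<times> C" by (auto simp: siblings_def)
  have pt_iff: "rect_mem L R B T p q i \<longleftrightarrow> rect_mem l r b t p q (fst i) \<and> rect_mem l r b t p q (snd i)" for p q i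
    by (auto simp: rect_mem_def L_def R_def B_def T_def)
  have "colourable sibs (\<lambda>i j. i \<noteq> j \<and> interval_meets L R i j \<and> interval_meets B T i j) (antichain_bound (w * w))"
    unfolding antichain_bound_def
  proof (rule rectangle_intersection_colouring)
    show "finite sibs" using sibsC fin finite_subset by blast
    show "L i \<le> R i \<and> B i \<le> T i" if "i \<in> sibs" for i
    proof -
      have "fst i \<in> C" "snd i \<in> C" "fst i \<frown> snd i" using that by (auto simp: siblings_def)
      then show ?thesis
        using lr[of "fst i"] lr[of "snd i"] bt[of "fst i"] bt[of "snd i"]
        by (auto simp: L_def R_def B_def T_def rect_ov_def interval_meets_def)
    qed
    show "card {i\<in>sibs. rect_mem L R B T p q i} \<le> w * w" for p q
    proof -
      have "{i\<in>sibs. rect_mem L R B T p q i} = {(u, v). (u, v) \<in> sibs \<and> rect_mem l r b t p q u \<and> rect_mem l r b t p q v}"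
        by (auto simp: pt_iff)
      then show ?thesis using sibs_depth[of p q] by simp
    qed
  qed
  then obtain \<gamma> where \<gamma>: "\<forall>i\<in>sibs. \<gamma> i < antichain_bound (w * w)"
      "\<forall>i\<in>sibs. \<forall>j\<in>sibs. i \<noteq> j \<and> interval_meets L R i j \<and> interval_meets B T i j \<longrightarrow> \<gamma> i \<noteq> \<gamma> j"
    unfolding colourable_def by (elim exE conjE) (rule that)
  define reg where "reg x i \<longleftrightarrow> i \<in> sibs \<and> rect_mem L R B T (l x) (b x) i" for x i
  have uniq: "i = j" if "reg x i" "reg x j" "\<gamma> i = \<gamma> j" for x i j
  proof (rule ccontr)
    assume "i \<noteq> j"
    moreover have "interval_meets L R i j" "interval_meets B T i j" using that(1,2) unfolding reg_def rect_mem_def interval_meets_def by linarith+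
    ultimately show False using \<gamma>(2) that by (simp add: reg_def)
  qed
  define E where "E k x y \<longleftrightarrow> x \<frown> y \<and> (\<exists>i. reg x i \<and> reg y i \<and> \<gamma> i = k)" for k x y
  have "colourable C (E k) (2 * line_bound w)" for k
  \<comment> \<open>The group of \<open>x\<close> is the region of colour \<open>k\<close> that
    holds its corner. Where there is none the choice is arbitrary, but then \<open>x\<close> has no
    \<open>E k\<close>-neighbour.\<close>
  proof (rule colourable_groups[where k = "\<lambda>x. SOME i. reg x i \<and> \<gamma> i = k"])
    have key: "(SOME i. reg x i \<and> \<gamma> i = k) = i" if "reg x i" "\<gamma> i = k" for x i
    proof (rule some_equality)
      show "j = i" if "reg x j \<and> \<gamma> j = k" for j using uniq[of x j i] that \<open>reg x i\<close> \<open>\<gamma> i = k\<close> by simp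
    qed (use that in simp)
    show "(SOME i. reg x i \<and> \<gamma> i = k) = (SOME i. reg y i \<and> \<gamma> i = k)" if "E k x y" for x y
    proof -
      obtain i where i: "reg x i" "reg y i" "\<gamma> i = k" using \<open>E k x y\<close> unfolding E_def by (elim conjE exE) (rule that)
      show ?thesis by (simp only: key[OF i(1,3)] key[OF i(2,3)])
    qed
    fix c
    show "colourable {x\<in>C. (SOME i. reg x i \<and> \<gamma> i = k) = c} (E k) (2 * line_bound w)"
    proof (cases "c \<in> sibs")
      case True
      then have c: "fst c \<in> C" "snd c \<in> C" "fst c \<frown> snd c" by (auto simp: siblings_def)
      have "colourable {x\<in>C. rect_mem l r b t (l x) (b x) (fst c) \<and> rect_mem l r b t (l x) (b x) (snd c)} (E k) (2 * line_bound w)"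
        by (rule colourable_mono[OF sib_region_colouring[OF c]]) (auto simp: E_def)
      then show ?thesis
      proof (rule colourable_support[OF _ n])
        fix x y assume xy: "x \<in> {x\<in>C. (SOME i. reg x i \<and> \<gamma> i = k) = c}"
          "y \<in> {x\<in>C. (SOME i. reg x i \<and> \<gamma> i = k) = c}" "E k x y"
        then obtain i where i: "reg x i" "reg y i" "\<gamma> i = k" unfolding E_def by (elim conjE exE) (rule that)
        have "i = c" using key[OF i(1,3)] xy(1) by simp
        then have "reg x c" "reg y c" using i by simp_all
        then show "x \<in> {x\<in>C. rect_mem l r b t (l x) (b x) (fst c) \<and> rect_mem l r b t (l x) (b x) (snd c)} \<and>
          y \<in> {x\<in>C. rect_mem l r b t (l x) (b x) (fst c) \<and> rect_mem l r b t (l x) (b x) (snd c)}"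
          using xy(1,2) by (simp add: reg_def pt_iff)
      qed
    next
      case False
      show ?thesis
      proof (rule colourableI[where f = "\<lambda>_. 0"])
        fix x y assume "x \<in> {x\<in>C. (SOME i. reg x i \<and> \<gamma> i = k) = c}" "E k x y"
        then obtain i where i: "reg x i" "\<gamma> i = k" unfolding E_def by (elim conjE exE) (rule that)
        then have "c = i"
          using key[OF i] \<open>x \<in> {x\<in>C. (SOME i. reg x i \<and> \<gamma> i = k) = c}\<close> by simp
        then show "(0::nat) \<noteq> 0" using i(1) False by (simp add: reg_def)
      qed (use n in simp)
    qed
  qed
  then have "colourable C (\<lambda>x y. \<exists>k<antichain_bound (w * w). E k x y) (corner_bound w)"
    unfolding corner_bound_def by (intro colourable_finite_Union)
  then show ?thesis
  proof (rule colourable_mono)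
    fix x y assume xy: "x \<in> C" "y \<in> C" "corner_clash l b l r b t C x y"
    then obtain p s where ps: "p \<in> C" "s \<in> C" "p \<frown> s"
      "rect_mem l r b t (l x) (b x) p" "rect_mem l r b t (l x) (b x) s" "rect_mem l r b t (l y) (b y) p" "rect_mem l r b t (l y) (b y) s"
      unfolding corner_clash_def by blast
    obtain u v where uv: "(u, v) \<in> sibs" "p \<sqsubseteq> u" "s \<sqsubseteq> v" using sibs_above[OF ps(1-3)] by blast
    have up: "rect_mem l r b t a c z" if "rect_mem l r b t a c z'" "z' \<sqsubseteq> z" for a c z z'
      using that by (auto simp: rect_mem_def rect_sub_def interval_le_def)
    have "reg x (u, v)" "reg y (u, v)"
      unfolding reg_def pt_iff using uv(1) up[OF ps(4) uv(2)] up[OF ps(5) uv(3)] up[OF ps(6) uv(2)] up[OF ps(7) uv(3)]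
      by simp_all
    moreover have "x \<frown> y" using xy(3) by (simp add: corner_clash_def)
    ultimately have "E (\<gamma> (u, v)) x y" unfolding E_def by blast
    then show "\<exists>k<antichain_bound (w * w). E k x y" using \<gamma>(1) uv(1) by blast
  qed simp_all
qed (simp add: colourable_def)

definition corner_free where
  "corner_free l r b t C \<longleftrightarrow> (\<forall>x\<in>C. \<forall>y\<in>C. \<not> corner_clash l b l r b t C x y \<and>
    \<not> corner_clash r b l r b t C x y \<and> \<not> corner_clash l t l r b t C x y \<and> \<not> corner_clash r t l r b t C x y)"

lemma corner_free_reflect [simp]:
  "corner_free (\<lambda>x. - r x) (\<lambda>x. - l x) b t C \<longleftrightarrow> corner_free l r b t C"
  "corner_free l r (\<lambda>x. - t x) (\<lambda>x. - b x) C \<longleftrightarrow> corner_free l r b t C"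
  unfolding corner_free_def corner_clash_reflect by auto

lemma corner_clash_transpose: "corner_clash X Y l r b t C = corner_clash Y X b t l r C"
  unfolding corner_clash_def fun_eq_iff rect_ov_transpose[of b t l r] rect_mem_def by auto

lemma corner_free_transpose: "corner_free b t l r C \<longleftrightarrow> corner_free l r b t C"
  unfolding corner_free_def corner_clash_transpose[of _ _ b t l r] by auto

lemma corner_free_subset:
  assumes "corner_free l r b t C" "D \<subseteq> C"
  shows "corner_free l r b t D"
proof -
  have "corner_clash X Y l r b t C x y" if "corner_clash X Y l r b t D x y" for X Y x y
    using that assms(2) unfolding corner_clash_def by blast
  then show ?thesis using assms subsetD[OF assms(2)] unfolding corner_free_def by metis
qed

lemma (in clean_family) corner_free_classes:
  assumes "\<And>D. D \<subseteq> C \<Longrightarrow> corner_free l r b t D \<Longrightarrow> tf_colourable D (rect_ov l r b t) m"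
  shows "tf_colourable C (rect_ov l r b t) (((corner_bound w * corner_bound w) * (corner_bound w * corner_bound w)) * m)"
proof -
  interpret x: clean_family "\<lambda>x. - r x" "\<lambda>x. - l x" b t C w
    using clean_family_axioms by simp
  interpret y: clean_family l r "\<lambda>x. - t x" "\<lambda>x. - b x" C w
    using clean_family_axioms by simp
  interpret xy: clean_family "\<lambda>x. - r x" "\<lambda>x. - l x" "\<lambda>x. - t x" "\<lambda>x. - b x" C w
    using clean_family_axioms by simp
  have "colourable C (corner_clash r b l r b t C) (corner_bound w)"
    using x.corner_clash_colouring by (simp only: corner_clash_reflect)
  moreover have "colourable C (corner_clash l t l r b t C) (corner_bound w)"
    using y.corner_clash_colouring by (simp only: corner_clash_reflect)
  moreover have "colourable C (corner_clash r t l r b t C) (corner_bound w)"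
    using xy.corner_clash_colouring by (simp only: corner_clash_reflect)
  ultimately have "colourable C (\<lambda>x y. (corner_clash l b l r b t C x y \<or> corner_clash r b l r b t C x y) \<or>
      (corner_clash l t l r b t C x y \<or> corner_clash r t l r b t C x y))
      ((corner_bound w * corner_bound w) * (corner_bound w * corner_bound w))"
    by (intro colourable_Un corner_clash_colouring)
  then show ?thesis
  proof (rule tf_colourable_classes)
    fix D assume D: "D \<subseteq> C" and no: "\<And>x y. x \<in> D \<Longrightarrow> y \<in> D \<Longrightarrow>
      \<not> ((corner_clash l b l r b t C x y \<or> corner_clash r b l r b t C x y) \<or>
      (corner_clash l t l r b t C x y \<or> corner_clash r t l r b t C x y))"
    have mono: "corner_clash X Y l r b t C x y" if "corner_clash X Y l r b t D x y" for X Y x y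
      using that D unfolding corner_clash_def by blast
    have "corner_free l r b t D" unfolding corner_free_def using no mono by meson
    then show "tf_colourable D (rect_ov l r b t) m" using assms D by blast
  qed
qed

section \<open>Side links and elbows\<close>

definition nested where
  "nested l r b t x y \<longleftrightarrow> interval_le l r x y \<or> interval_le l r y x \<or> interval_le b t x y \<or> interval_le b t y x"

text \<open>The witnesses range over the ambient \<open>C\<close>, so a link survives when only a
  colour class is kept. It also passes from rectangles to those inside them.\<close>

definition side_linked where
  "side_linked l r b t C x y \<longleftrightarrow>
    (\<exists>U\<in>C. \<exists>W\<in>C. rect_sub l r b t x U \<and> rect_sub l r b t y W \<and> rect_ov l r b t U W \<and> nested l r b t U W)"

lemma nested_reflect [simp]:
  "nested (\<lambda>x. - r x) (\<lambda>x. - l x) b t = nested l r b t"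
  "nested l r (\<lambda>x. - t x) (\<lambda>x. - b x) = nested l r b t"
  by (simp_all add: nested_def fun_eq_iff)

lemma nested_sym: "nested l r b t x y \<Longrightarrow> nested l r b t y x"
  by (auto simp: nested_def)

lemma side_linked_reflect [simp]:
  "side_linked (\<lambda>x. - r x) (\<lambda>x. - l x) b t C = side_linked l r b t C"
  "side_linked l r (\<lambda>x. - t x) (\<lambda>x. - b x) C = side_linked l r b t C"
  by (simp_all add: side_linked_def fun_eq_iff)

lemma side_linked_sym: "side_linked l r b t C x y \<Longrightarrow> side_linked l r b t C y x"
  unfolding side_linked_def by (elim bexE conjE) (intro bexI conjI; (rule ov_sym nested_sym)?; assumption)

lemma corner_freeD:
  assumes "corner_free l r b t C" "x \<in> C" "y \<in> C" "p \<in> C" "s \<in> C" "rect_ov l r b t x y" "rect_ov l r b t p s"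
  shows "rect_mem l r b t (l x) (b x) p \<Longrightarrow> rect_mem l r b t (l x) (b x) s \<Longrightarrow> rect_mem l r b t (l y) (b y) p \<Longrightarrow> rect_mem l r b t (l y) (b y) s \<Longrightarrow> False"
    "rect_mem l r b t (r x) (b x) p \<Longrightarrow> rect_mem l r b t (r x) (b x) s \<Longrightarrow> rect_mem l r b t (r y) (b y) p \<Longrightarrow> rect_mem l r b t (r y) (b y) s \<Longrightarrow> False"
    "rect_mem l r b t (l x) (t x) p \<Longrightarrow> rect_mem l r b t (l x) (t x) s \<Longrightarrow> rect_mem l r b t (l y) (t y) p \<Longrightarrow> rect_mem l r b t (l y) (t y) s \<Longrightarrow> False"
proof -
  have *: "\<not> corner_clash l b l r b t C x y" "\<not> corner_clash r b l r b t C x y" "\<not> corner_clash l t l r b t C x y"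
    using assms(1-3) unfolding corner_free_def by simp_all
  have clash: "corner_clash X Y l r b t C x y"
    if "rect_mem l r b t (X x) (Y x) p" "rect_mem l r b t (X x) (Y x) s" "rect_mem l r b t (X y) (Y y) p" "rect_mem l r b t (X y) (Y y) s" for X Y
    unfolding corner_clash_def using assms(6,7) that
    by (intro conjI bexI[OF _ assms(4)] bexI[OF _ assms(5)])
  show "rect_mem l r b t (l x) (b x) p \<Longrightarrow> rect_mem l r b t (l x) (b x) s \<Longrightarrow> rect_mem l r b t (l y) (b y) p \<Longrightarrow> rect_mem l r b t (l y) (b y) s \<Longrightarrow> False"
    using *(1) clash[of l b] by (rule notE)
  show "rect_mem l r b t (r x) (b x) p \<Longrightarrow> rect_mem l r b t (r x) (b x) s \<Longrightarrow> rect_mem l r b t (r y) (b y) p \<Longrightarrow> rect_mem l r b t (r y) (b y) s \<Longrightarrow> False"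
    using *(2) clash[of r b] by (rule notE)
  show "rect_mem l r b t (l x) (t x) p \<Longrightarrow> rect_mem l r b t (l x) (t x) s \<Longrightarrow> rect_mem l r b t (l y) (t y) p \<Longrightarrow> rect_mem l r b t (l y) (t y) s \<Longrightarrow> False"
    using *(3) clash[of l t] by (rule notE)
qed

text \<open>These prongs all contain the bottom left corner of \<open>Q\<close>; being an antichain,
  there are at most \<open>w\<close>. Colour \<open>z\<close> by a chosen prong \<open>V\<close>
  that it overlaps. The bottom left corner of \<open>z\<close> lies in \<open>Q\<close> and
  \<open>V\<close>, so an overlapping pair with the same \<open>V\<close> would clash.\<close>

lemma (in clean_family) corner_prong_colouring:
  assumes cf: "corner_free l r b t C" and Q: "Q \<in> C"
  shows "colourable {z\<in>C. z \<sqsubseteq> Q \<and> (\<exists>V\<in>prongs Q. z \<frown> V \<and> l V \<le> l Q \<and> b V \<le> b Q)} (rect_ov l r b t) w"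
proof -
  define G where "G = {z\<in>C. z \<sqsubseteq> Q \<and> (\<exists>V\<in>prongs Q. z \<frown> V \<and> l V \<le> l Q \<and> b V \<le> b Q)}"
  define P where "P = {V\<in>prongs Q. l V \<le> l Q \<and> b V \<le> b Q}"
  have PC: "P \<subseteq> C" by (auto simp: P_def prongs_of_def)
  have "card P \<le> w"
  proof (rule pt_clique[OF PC])
    fix V assume "V \<in> P"
    then have "Q \<frown> V" "l V \<le> l Q" "b V \<le> b Q" using prongsD(2) by (auto simp: P_def)
    then show "rect_mem l r b t (l Q) (b Q) V" by (auto simp: rect_mem_def rect_ov_def interval_meets_def)
  next
    fix V W assume "V \<in> P" "W \<in> P" "V \<sqsubseteq> W"
    then show "V = W" using prongs_antichain[of V Q W] by (simp add: P_def)
  qed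
  have "finite P" using PC fin by (rule finite_subset)
  then obtain h where h: "bij_betw h P {0..<card P}" using ex_bij_betw_finite_nat by blast
  have "\<forall>z\<in>G. \<exists>V. V \<in> P \<and> z \<frown> V" by (auto simp: G_def P_def)
  from bchoice[OF this] obtain v where v: "\<forall>z\<in>G. v z \<in> P \<and> z \<frown> v z" by (elim exE) (rule that)
  have "colourable G (rect_ov l r b t) w"
  proof (rule colourableI[where f = "\<lambda>z. h (v z)"])
    fix z assume "z \<in> G"
    then have "v z \<in> P" using v by blast
    then have "h (v z) \<in> {0..<card P}" using bij_betw_apply[OF h] by blast
    then show "h (v z) < w" using \<open>card P \<le> w\<close> by simp
  next
    fix x y assume xy: "x \<in> G" "y \<in> G" "x \<frown> y"
    show "h (v x) \<noteq> h (v y)"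
    proof
      assume "h (v x) = h (v y)"
      then have eq: "v x = v y" using h v xy(1,2) by (auto simp: bij_betw_def inj_on_def)
      define V where "V = v x"
      have V: "V \<in> P" "x \<frown> V" "y \<frown> V" using v xy(1,2) eq by (auto simp: V_def)
      have Vp: "V \<in> prongs Q" "l V \<le> l Q" "b V \<le> b Q" using V(1) by (auto simp: P_def)
      have C: "x \<in> C" "y \<in> C" "x \<sqsubseteq> Q" "y \<sqsubseteq> Q" using xy(1,2) by (auto simp: G_def)
      have ptQ: "rect_mem l r b t (l z) (b z) Q" if "z \<in> C" "z \<sqsubseteq> Q" for z
        using that lr[OF that(1)] bt[OF that(1)] by (auto simp: rect_mem_def rect_sub_def interval_le_def)
      have ptV: "rect_mem l r b t (l z) (b z) V" if "z \<sqsubseteq> Q" "z \<frown> V" for z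
        using that Vp(2,3) by (auto simp: rect_mem_def rect_sub_def interval_le_def rect_ov_def interval_meets_def)
      show False
        using corner_freeD(1)[OF cf C(1,2) Q prongsD(1)[OF Vp(1)] xy(3) prongsD(2)[OF Vp(1)]]
          ptQ[OF C(1,3)] ptQ[OF C(2,4)] ptV[OF C(3) V(2)] ptV[OF C(4) V(3)] by blast
    qed
  qed
  then show ?thesis by (simp only: G_def)
qed

definition link_bound :: "nat \<Rightarrow> nat" where
  "link_bound w = 2 * antichain_bound w * ((w + w) + (w + w))"

text \<open>If \<open>z\<close> inside \<open>Q\<close> is not linked to the prong \<open>V\<close>,
  then \<open>Q\<close> and \<open>V\<close> are not nested, as they would themselves witness a
  link. So \<open>V\<close> contains a corner of \<open>Q\<close>, and the four corners are mirror
  images.\<close>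

lemma (in clean_family) side_linked_colouring:
  assumes cf: "corner_free l r b t C"
  shows "colourable C (\<lambda>x y. x \<frown> y \<and> \<not> side_linked l r b t C x y) (link_bound w)"
proof (cases "C = {}")
  case False
  then have "w > 0" using w_pos by blast
  then have n: "(w + w) + (w + w) > 0" by simp
  define H where "H x y \<longleftrightarrow> x \<frown> y \<and> \<not> side_linked l r b t C x y" for x y
  have x: "clean_family (\<lambda>x. - r x) (\<lambda>x. - l x) b t C w"
    and y: "clean_family l r (\<lambda>x. - t x) (\<lambda>x. - b x) C w"
    and xy: "clean_family (\<lambda>x. - r x) (\<lambda>x. - l x) (\<lambda>x. - t x) (\<lambda>x. - b x) C w"
    using clean_family_axioms by simp_all
  have "colourable C H (link_bound w)" unfolding link_bound_def
  proof (rule phase_colourable[OF _ _ _ n])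
    show "x \<frown> y" if "H x y" for x y using that by (simp add: H_def)
    show "H y x" if "H x y" for x y
      using that ov_sym[of l r b t x y] side_linked_sym[of l r b t C y x] by (auto simp: H_def)
    show "H x y" if "H z y" "z \<sqsubseteq> x" "\<not> y \<sqsubseteq> x" for x y z
    proof -
      \<comment> \<open>A link of \<open>x\<close> and \<open>y\<close> would also be one of
        \<open>z\<close> and \<open>y\<close>, as \<open>z\<close> lies inside
        \<open>x\<close>.\<close>
      have "\<not> side_linked l r b t C x y"
        using that(1) sub_trans[OF that(2)] unfolding H_def side_linked_def by blast
      then show ?thesis using ov_up[OF _ that(2,3)] that(1) by (simp add: H_def)
    qed
    fix Q assume Q: "Q \<in> C"
    let ?G = "\<lambda>P. {z\<in>C. z \<sqsubseteq> Q \<and> (\<exists>V\<in>prongs Q. z \<frown> V \<and> P V)}"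
    have "colourable (?G (\<lambda>V. l V \<le> l Q \<and> b V \<le> b Q)) (rect_ov l r b t) w"
      using cf Q by (rule corner_prong_colouring)
    moreover have "colourable (?G (\<lambda>V. r Q \<le> r V \<and> b V \<le> b Q)) (rect_ov l r b t) w"
      using clean_family.corner_prong_colouring[OF x _ Q] cf by simp
    moreover have "colourable (?G (\<lambda>V. l V \<le> l Q \<and> t Q \<le> t V)) (rect_ov l r b t) w"
      using clean_family.corner_prong_colouring[OF y _ Q] cf by simp
    moreover have "colourable (?G (\<lambda>V. r Q \<le> r V \<and> t Q \<le> t V)) (rect_ov l r b t) w"
      using clean_family.corner_prong_colouring[OF xy _ Q] cf by simp
    ultimately have col: "colourable ((?G (\<lambda>V. l V \<le> l Q \<and> b V \<le> b Q) \<union> ?G (\<lambda>V. r Q \<le> r V \<and> b V \<le> b Q)) \<union>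
        (?G (\<lambda>V. l V \<le> l Q \<and> t Q \<le> t V) \<union> ?G (\<lambda>V. r Q \<le> r V \<and> t Q \<le> t V))) (rect_ov l r b t) ((w + w) + (w + w))"
      by (intro colourable_cover[OF _ _ order.refl])
    show "colourable {z\<in>C. z \<sqsubseteq> Q \<and> (\<exists>V\<in>prongs Q. H z V)} H ((w + w) + (w + w))"
    proof (rule colourable_mono[OF col order.refl])
      show "x \<frown> y" if "H x y" for x y using that by (simp add: H_def)
      show "{z\<in>C. z \<sqsubseteq> Q \<and> (\<exists>V\<in>prongs Q. H z V)} \<subseteq>
         (?G (\<lambda>V. l V \<le> l Q \<and> b V \<le> b Q) \<union> ?G (\<lambda>V. r Q \<le> r V \<and> b V \<le> b Q)) \<union>
        (?G (\<lambda>V. l V \<le> l Q \<and> t Q \<le> t V) \<union> ?G (\<lambda>V. r Q \<le> r V \<and> t Q \<le> t V))"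
      proof
        fix z assume "z \<in> {z\<in>C. z \<sqsubseteq> Q \<and> (\<exists>V\<in>prongs Q. H z V)}"
        then obtain V where z: "z \<in> C" "z \<sqsubseteq> Q" and V: "V \<in> prongs Q" "z \<frown> V" "\<not> side_linked l r b t C z V"
          by (auto simp: H_def)
        have "\<not> nested l r b t Q V"
          using V(3) z(2) Q prongsD[OF V(1)] sub_refl unfolding side_linked_def by blast
        then have "(l V \<le> l Q \<or> r Q \<le> r V) \<and> (b V \<le> b Q \<or> t Q \<le> t V)"
          unfolding nested_def interval_le_def by linarith
        then show "z \<in> (?G (\<lambda>V. l V \<le> l Q \<and> b V \<le> b Q) \<union> ?G (\<lambda>V. r Q \<le> r V \<and> b V \<le> b Q)) \<union>
          (?G (\<lambda>V. l V \<le> l Q \<and> t Q \<le> t V) \<union> ?G (\<lambda>V. r Q \<le> r V \<and> t Q \<le> t V))"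
          using z V(1,2) by blast
      qed
    qed
  qed
  then show ?thesis by (rule colourable_mono) (simp_all add: H_def)
qed (simp add: colourable_def)

section \<open>Excluding elbows\<close>

text \<open>The bottom left corner of \<open>A\<close> lies in \<open>B\<close> and in
  \<open>E\<close>. By corner-freeness those of \<open>B\<close> and \<open>E\<close> do not; with
  crossings excluded, \<open>B\<close> must stick out of \<open>E\<close> to the left and
  \<open>E\<close> out of \<open>B\<close> below. Each way of nesting the linking pair
  \<open>U\<close>, \<open>W\<close> then yields a corner clash.\<close>

lemma (in clean_family) no_elbow_right_top:
  assumes cf: "corner_free l r b t C" and C: "A \<in> C" "B \<in> C" "E \<in> C"
    and AB: "A \<frown> B" "interval_le b t A B" "l B < l A" "r B < r A"
    and AE: "A \<frown> E" "interval_le l r A E" "b E < b A" "t E < t A"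
    and linked: "B \<frown> E \<Longrightarrow> side_linked l r b t C B E"
  shows False
proof -
  have x: "l A \<le> r B" "l E \<le> l A" "r A \<le> r E" and y: "b A \<le> t E" "b B \<le> b A" "t A \<le> t B"
    using AB AE by (auto simp: rect_ov_def interval_meets_def interval_le_def)
  note ineq = x y AB(3,4) AE(3,4) lr[OF C(1)] bt[OF C(1)]
  have BE: "B \<frown> E" using ineq by (auto simp: rect_ov_def interval_meets_def rect_sub_def interval_le_def)
  have up: "rect_mem l r b t p q W" if "rect_mem l r b t p q V" "V \<sqsubseteq> W" for p q V W
    using that by (auto simp: rect_mem_def rect_sub_def interval_le_def)
  have A: "rect_mem l r b t (l A) (b A) B" "rect_mem l r b t (l A) (b A) E"
    using ineq unfolding rect_mem_def by linarith+
  have self: "rect_mem l r b t (l V) (b V) V" "rect_mem l r b t (l V) (t V) V" "rect_mem l r b t (r V) (b V) V" if "V \<in> C" for V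
    using lr[OF that] bt[OF that] by (auto simp: rect_mem_def)
  have E1: False if "l B \<le> l E" "b B \<le> b E"
  proof -
    have "rect_mem l r b t (l E) (b E) B" using that ineq unfolding rect_mem_def by linarith
    then show False using corner_freeD(1)[OF cf C(1,3,2,3) AE(1) BE] A self(1)[OF C(3)] by blast
  qed
  have E2: False if "l E \<le> l B" "b E \<le> b B"
  proof -
    have "rect_mem l r b t (l B) (b B) E" using that ineq unfolding rect_mem_def by linarith
    then show False using corner_freeD(1)[OF cf C(1,2,2,3) AB(1) BE] A self(1)[OF C(2)] by blast
  qed
  have E3: False if "l E \<le> l B" "b B \<le> b E"
  proof -
    have "interval_le l r B E" "interval_le b t E B" using that ineq unfolding interval_le_def by linarith+
    then show False using noncross[OF C(2,3) BE] by blast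
  qed
  have lb: "l B < l E" "b E < b B"
    using E1 E2 E3 linear[of "b E" "b B"] linear[of "l E" "l B"] by (meson not_le)+
  note ineq = ineq lb
  obtain U W where UW: "U \<in> C" "W \<in> C" "B \<sqsubseteq> U" "E \<sqsubseteq> W" "U \<frown> W" "nested l r b t U W"
    using linked[OF BE] unfolding side_linked_def by blast
  have nsub: "\<not> B \<sqsubseteq> W" "\<not> E \<sqsubseteq> U"
    using clean[OF UW(1,2) C(2) UW(5,3)] clean[OF UW(1,2) C(3) UW(5) _ UW(4)] by blast+
  have "W \<frown> B" using ov_up[OF ov_sym[OF BE] UW(4) nsub(1)] .
  then have BW: "B \<frown> W" by (rule ov_sym)
  have "U \<frown> E" using ov_up[OF BE UW(3) nsub(2)] .
  then have EU: "E \<frown> U" by (rule ov_sym)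
  have U: "l U \<le> l B" "r B \<le> r U" "b U \<le> b B" "t B \<le> t U"
    and W: "l W \<le> l E" "r E \<le> r W" "b W \<le> b E" "t E \<le> t W"
    using UW(3,4) by (auto simp: rect_sub_def interval_le_def)
  \<comment> \<open>The clashes are, in order: \<open>A\<close>, \<open>E\<close> at the bottom left
    in \<open>U\<close> and \<open>W\<close>; \<open>A\<close>, \<open>E\<close> at the top left in
    \<open>B\<close> and \<open>W\<close>; \<open>A\<close>, \<open>B\<close> at the bottom left in
    \<open>B\<close> and \<open>W\<close>; \<open>A\<close>, \<open>B\<close> at the bottom right in
    \<open>E\<close> and \<open>U\<close>.\<close>
  consider "interval_le b t W U" | "interval_le b t U W" | "interval_le l r U W" | "interval_le l r W U"
    using UW(6) unfolding nested_def by blast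
  then show False
  proof cases
    case 1
    then have "rect_mem l r b t (l E) (b E) U" using ineq U W unfolding rect_mem_def interval_le_def by linarith
    then show False
      using corner_freeD(1)[OF cf C(1,3) UW(1,2) AE(1) UW(5)] up[OF A(1) UW(3)] up[OF A(2) UW(4)]
        up[OF self(1)[OF C(3)] UW(4)] by blast
  next
    case 2
    then have "rect_mem l r b t (l A) (t A) B" "rect_mem l r b t (l A) (t A) W"
      "rect_mem l r b t (l E) (t E) B" "rect_mem l r b t (l E) (t E) W"
      using ineq U W unfolding rect_mem_def interval_le_def by linarith+
    then show False using corner_freeD(3)[OF cf C(1,3,2) UW(2) AE(1) BW] by blast
  next
    case 3
    then have "rect_mem l r b t (l B) (b B) W" using ineq U W unfolding rect_mem_def interval_le_def by linarith
    then show False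
      using corner_freeD(1)[OF cf C(1,2,2) UW(2) AB(1) BW] A(1) up[OF A(2) UW(4)] self(1)[OF C(2)] by blast
  next
    case 4
    then have "rect_mem l r b t (r A) (b A) E" "rect_mem l r b t (r A) (b A) U"
      "rect_mem l r b t (r B) (b B) E" "rect_mem l r b t (r B) (b B) U"
      using ineq U W unfolding rect_mem_def interval_le_def by linarith+
    then show False using corner_freeD(2)[OF cf C(1,2,3) UW(1) AB(1) EU] by blast
  qed
qed

text \<open>As containment and crossing are excluded, \<open>B\<close> is shifted horizontally and
  \<open>E\<close> vertically against \<open>A\<close>. The four combinations are mirror images of
  one.\<close>

lemma (in clean_family) no_elbow:
  assumes cf: "corner_free l r b t C" and C: "A \<in> C" "B \<in> C" "E \<in> C"
    and AB: "A \<frown> B" "interval_le b t A B"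
    and AE: "A \<frown> E" "interval_le l r A E"
    and linked: "B \<frown> E \<Longrightarrow> side_linked l r b t C B E"
  shows False
proof -
  have x: "clean_family (\<lambda>x. - r x) (\<lambda>x. - l x) b t C w"
    and y: "clean_family l r (\<lambda>x. - t x) (\<lambda>x. - b x) C w"
    and xy: "clean_family (\<lambda>x. - r x) (\<lambda>x. - l x) (\<lambda>x. - t x) (\<lambda>x. - b x) C w"
    using clean_family_axioms by simp_all
  have "\<not> interval_le l r A B" "\<not> interval_le l r B A"
    using AB ov_not_sub[OF AB(1)] noncross[OF C(2,1) ov_sym[OF AB(1)]] by (auto simp: rect_sub_def)
  then have 1: "(l B < l A \<and> r B < r A) \<or> (r A < r B \<and> l A < l B)" unfolding interval_le_def by linarith
  have "\<not> interval_le b t A E" "\<not> interval_le b t E A"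
    using AE ov_not_sub[OF AE(1)] noncross[OF C(1,3) AE(1)] by (auto simp: rect_sub_def)
  then have 2: "(b E < b A \<and> t E < t A) \<or> (t A < t E \<and> b A < b E)" unfolding interval_le_def by linarith
  show False
    using 1 2
  proof (elim disjE conjE)
    assume "l B < l A" "r B < r A" "b E < b A" "t E < t A"
    then show False using no_elbow_right_top[OF cf C AB _ _ AE _ _ linked] by blast
  next
    assume "r A < r B" "l A < l B" "b E < b A" "t E < t A"
    then show False using clean_family.no_elbow_right_top[OF x _ C] cf AB AE linked by simp
  next
    assume "l B < l A" "r B < r A" "t A < t E" "b A < b E"
    then show False using clean_family.no_elbow_right_top[OF y _ C] cf AB AE linked by simp
  next
    assume "r A < r B" "l A < l B" "t A < t E" "b A < b E"
    then show False using clean_family.no_elbow_right_top[OF xy _ C] cf AB AE linked by simp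
  qed
qed

section \<open>Families with only horizontal overlaps\<close>

lemma (in clean_family) no_ordered_triangle:
  assumes cf: "corner_free l r b t C"
    and nonest: "\<And>x y. x \<in> C \<Longrightarrow> y \<in> C \<Longrightarrow> x \<frown> y \<Longrightarrow> \<not> interval_le l r x y"
    and noleft: "\<And>x y. x \<in> C \<Longrightarrow> y \<in> C \<Longrightarrow> x \<frown> y \<Longrightarrow> l x < l y \<Longrightarrow> \<not> interval_le b t x y"
    and C: "x \<in> C" "y \<in> C" "z \<in> C" and tri: "x \<frown> y" "y \<frown> z" "x \<frown> z"
    and less: "l x < l y" "l y < l z" and linked: "side_linked l r b t C x y"
  shows False
proof -
  obtain U W where UW: "U \<in> C" "W \<in> C" "x \<sqsubseteq> U" "y \<sqsubseteq> W" "U \<frown> W" "nested l r b t U W"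
    using linked unfolding side_linked_def by blast
  have "\<not> interval_le l r U W" "\<not> interval_le l r W U"
    using nonest[OF UW(1,2,5)] nonest[OF UW(2,1) ov_sym[OF UW(5)]] by blast+
  then consider "interval_le b t U W" | "interval_le b t W U" using UW(6) unfolding nested_def by blast
  then show False
  proof cases
    case 1
    \<comment> \<open>Here \<open>noleft\<close> makes \<open>W\<close> start no later than
      \<open>x\<close>, so by \<open>nonest\<close> it ends before \<open>x\<close>. Then
      \<open>y\<close>, lying in \<open>W\<close>, has its x-interval inside that of
      \<open>x\<close>.\<close>
    have "\<not> x \<sqsubseteq> W" using clean[OF UW(1,2) C(1) UW(5,3)] by blast
    then have Wx: "W \<frown> x" using ov_up[OF ov_sym[OF tri(1)] UW(4)] by blast
    have n: "interval_le b t x W" using 1 UW(3) by (auto simp: interval_le_def rect_sub_def)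
    have "\<not> l x < l W" using noleft[OF C(1) UW(2) ov_sym[OF Wx]] n by blast
    moreover have "\<not> interval_le l r x W" using nonest[OF C(1) UW(2) ov_sym[OF Wx]] .
    moreover have "\<not> interval_le l r y x" using nonest[OF C(2,1) ov_sym[OF tri(1)]] .
    ultimately show False using less UW(4) unfolding interval_le_def rect_sub_def by linarith
  next
    case 2
    \<comment> \<open>Here \<open>U\<close> covers the y-interval of \<open>y\<close> and the left
      ends of \<open>y\<close> and \<open>z\<close>. By \<open>noleft\<close>, \<open>y\<close>
      extends beyond \<open>z\<close> below or above, so the bottom left or the top left corners of
      \<open>y\<close> and \<open>z\<close> both lie in \<open>U\<close> and
      \<open>y\<close>.\<close>
    have "\<not> y \<sqsubseteq> U" using clean[OF UW(1,2) C(2) UW(5) _ UW(4)] by blast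
    then have Uy: "U \<frown> y" using ov_up[OF tri(1) UW(3)] by blast
    have n: "interval_le b t y U" using 2 UW(4) by (auto simp: interval_le_def rect_sub_def)
    have "\<not> l y < l U" using noleft[OF C(2) UW(1) ov_sym[OF Uy]] n by blast
    moreover have "l y \<le> r x" "l z \<le> r x" "l z \<le> r y" "b z \<le> t y" "b y \<le> t z"
      using tri by (auto simp: rect_ov_def interval_meets_def)
    moreover have "r x \<le> r U" "b U \<le> b y" "t y \<le> t U" using UW(3) n by (auto simp: rect_sub_def interval_le_def)
    ultimately have ineq: "l U \<le> l y" "l y \<le> r x" "l z \<le> r x" "l z \<le> r y" "b z \<le> t y" "b y \<le> t z"
      "r x \<le> r U" "b U \<le> b y" "t y \<le> t U" by linarith+
    have "\<not> interval_le b t y z" using noleft[OF C(2,3) tri(2) less(2)] .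
    then consider "b y < b z" | "t z < t y" unfolding interval_le_def by linarith
    then show False
    proof cases
      case 1
      then have "rect_mem l r b t (l y) (b y) U" "rect_mem l r b t (l y) (b y) y"
        "rect_mem l r b t (l z) (b z) U" "rect_mem l r b t (l z) (b z) y"
        using ineq less lr[OF C(2)] bt[OF C(2)] unfolding rect_mem_def by linarith+
      then show False using corner_freeD(1)[OF cf C(2,3) UW(1) C(2) tri(2) Uy] by blast
    next
      case 2
      then have "rect_mem l r b t (l y) (t y) U" "rect_mem l r b t (l y) (t y) y"
        "rect_mem l r b t (l z) (t z) U" "rect_mem l r b t (l z) (t z) y"
        using ineq less lr[OF C(2)] bt[OF C(2)] unfolding rect_mem_def by linarith+
      then show False using corner_freeD(3)[OF cf C(2,3) UW(1) C(2) tri(2) Uy] by blast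
    qed
  qed
qed

text \<open>Once unlinked overlaps are separated, every triangle, sorted by left ends, is excluded;
  the classes may still contain edges.\<close>

lemma (in clean_family) tf_colourable_rightward:
  assumes cf: "corner_free l r b t C"
    and nonest: "\<And>x y. x \<in> C \<Longrightarrow> y \<in> C \<Longrightarrow> x \<frown> y \<Longrightarrow> \<not> interval_le l r x y"
    and noleft: "\<And>x y. x \<in> C \<Longrightarrow> y \<in> C \<Longrightarrow> x \<frown> y \<Longrightarrow> l x < l y \<Longrightarrow> \<not> interval_le b t x y"
  shows "tf_colourable C (rect_ov l r b t) (link_bound w * 1)"
proof (rule tf_colourable_classes[OF side_linked_colouring[OF cf]])
  fix D assume D: "D \<subseteq> C" and linked: "\<And>x y. x \<in> D \<Longrightarrow> y \<in> D \<Longrightarrow> \<not> (x \<frown> y \<and> \<not> side_linked l r b t C x y)"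
  have no: False if "x \<in> D" "y \<in> D" "z \<in> D" "x \<frown> y" "y \<frown> z" "x \<frown> z" "l x < l y" "l y < l z" for x y z
  proof -
    have "x \<in> C" "y \<in> C" "z \<in> C" using that D by auto
    moreover have "side_linked l r b t C x y" using linked that by blast
    ultimately show False using no_ordered_triangle[OF cf nonest noleft] that by blast
  qed
  show "tf_colourable D (rect_ov l r b t) 1"
  proof (rule tf_colourable_trivial)
    fix x y z assume *: "x \<in> D" "y \<in> D" "z \<in> D" "x \<frown> y" "y \<frown> z" "x \<frown> z"
    have ne: "l u \<noteq> l v" if "u \<in> D" "v \<in> D" "u \<frown> v" for u v
      using genD(4)[OF genx, of u v] that D ov_irrefl[of u] by auto
    have s: "y \<frown> x" "z \<frown> y" "z \<frown> x" using *(4-6)[THEN ov_sym] by simp_all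
    have "l x \<noteq> l y" "l y \<noteq> l z" "l x \<noteq> l z" using ne * by simp_all
    then consider "l x < l y" "l y < l z" | "l x < l z" "l z < l y" | "l y < l x" "l x < l z"
      | "l y < l z" "l z < l x" | "l z < l x" "l x < l y" | "l z < l y" "l y < l x" by linarith
    then show False
      by cases (rule no[OF *(1,2,3) *(4,5,6)] no[OF *(1,3,2) *(6) s(2) *(4)] no[OF *(2,1,3) s(1) *(6,5)]
        no[OF *(2,3,1) *(5) s(3,1)] no[OF *(3,1,2) s(3) *(4) s(2)] no[OF *(3,2,1) s(2,1,3)], assumption+)+
  qed
qed

text \<open>Overlaps whose left rectangle has the smaller y-interval are transitive here. The
  y-interval of the third rectangle contains that of the first, which replaces the common line in
  \<open>right_prong_reach\<close>. Separating these overlaps leaves a rightward family.\<close>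

lemma (in clean_family) right_prong_tf_colourable:
  assumes cf: "corner_free l r b t C"
    and nonest: "\<And>x y. x \<in> C \<Longrightarrow> y \<in> C \<Longrightarrow> x \<frown> y \<Longrightarrow> \<not> interval_le l r x y"
    and Q: "Q \<in> C"
  shows "tf_colourable {z\<in>C. z \<sqsubseteq> Q \<and> (\<exists>V\<in>prongs Q. z \<frown> V \<and> r Q < r V)} (rect_ov l r b t) (w * (link_bound w * 1))"
proof -
  define G where "G = {z\<in>C. z \<sqsubseteq> Q \<and> (\<exists>V\<in>prongs Q. z \<frown> V \<and> r Q < r V)}"
  have GC: "G \<subseteq> C" by (auto simp: G_def)
  define R where "R x y \<longleftrightarrow> x \<frown> y \<and> l x < l y \<and> interval_le b t x y" for x y
  have R: "r x < r y" if "R x y" "x \<in> C" "y \<in> C" for x y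
    using that nonest[of y x] ov_sym[of l r b t x y] by (auto simp: R_def interval_le_def)
  have "colourable G (\<lambda>x y. R x y \<or> R y x) w"
  proof (rule colourable_heights)
    show "finite G" using GC fin by (rule finite_subset)
    show "\<not> R x x" for x using ov_irrefl by (auto simp: R_def)
    show "card K \<le> w" if "K \<subseteq> G" "\<And>x y. x \<in> K \<Longrightarrow> y \<in> K \<Longrightarrow> x \<noteq> y \<Longrightarrow> R x y \<or> R y x" for K
      by (rule cliques) (use that GC in \<open>auto simp: R_def dest: ov_sym\<close>)
    fix x y z assume *: "x \<in> G" "y \<in> G" "z \<in> G" "R x y" "R y z"
    then have C: "x \<in> C" "y \<in> C" "z \<in> C" using GC by auto
    have lt: "l x < l y" "l y < l z" "r x < r y" "r y < r z" using * C R by (auto simp: R_def)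
    have n: "interval_le b t x z" using *(4,5) by (auto simp: R_def interval_le_def)
    obtain V where V: "V \<in> prongs Q" "x \<frown> V" "r Q < r V" using *(1) unfolding G_def by blast
    have z: "z \<sqsubseteq> Q" using *(3) by (auto simp: G_def)
    have "interval_meets b t z V" using V(2) n by (auto simp: rect_ov_def interval_meets_def interval_le_def)
    with nonest Q C(3) z V have "l z \<le> r x" by (rule right_prong_reach)
    moreover have "interval_meets b t x z" using n bt[OF C(1)] by (auto simp: interval_le_def interval_meets_def)
    ultimately have "x \<frown> z"
      using lt lr[OF C(1)] lr[OF C(3)] by (auto simp: rect_ov_def interval_meets_def rect_sub_def interval_le_def)
    then show "R x z" using lt n by (simp add: R_def)
  qed
  then have "tf_colourable G (rect_ov l r b t) (w * (link_bound w * 1))"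
  proof (rule tf_colourable_classes)
    fix D assume D: "D \<subseteq> G" and no: "\<And>x y. x \<in> D \<Longrightarrow> y \<in> D \<Longrightarrow> \<not> (R x y \<or> R y x)"
    have DC: "D \<subseteq> C" using D GC by auto
    show "tf_colourable D (rect_ov l r b t) (link_bound w * 1)"
    proof (rule clean_family.tf_colourable_rightward)
      show "clean_family l r b t D w" using clean_family_axioms DC by (rule clean_family_subset)
      show "corner_free l r b t D" using cf DC by (rule corner_free_subset)
      show "\<not> interval_le l r x y" if "x \<in> D" "y \<in> D" "x \<frown> y" for x y using nonest that DC by blast
      show "\<not> interval_le b t x y" if "x \<in> D" "y \<in> D" "x \<frown> y" "l x < l y" for x y
        using no[OF that(1,2)] that(3,4) by (auto simp: R_def)
    qed
  qed
  then show ?thesis by (simp only: G_def)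
qed

definition nonest_bound :: "nat \<Rightarrow> nat" where
  "nonest_bound w = 2 * antichain_bound w * (w * (link_bound w * 1) + w * (link_bound w * 1))"

lemma (in clean_family) tf_colourable_nonest:
  assumes cf: "corner_free l r b t C"
    and nonest: "\<And>x y. x \<in> C \<Longrightarrow> y \<in> C \<Longrightarrow> x \<frown> y \<Longrightarrow> \<not> interval_le l r x y"
  shows "tf_colourable C (rect_ov l r b t) (nonest_bound w)"
proof (cases "C = {}")
  case False
  then have "w > 0" using w_pos by blast
  then have n: "w * (link_bound w * 1) + w * (link_bound w * 1) > 0" by (simp add: link_bound_def antichain_bound_def)
  have refl: "clean_family (\<lambda>x. - r x) (\<lambda>x. - l x) b t C w"
    using clean_family_axioms by simp
  show ?thesis unfolding nonest_bound_def
  proof (rule phase_tf_colourable[OF n])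
    fix Q assume Q: "Q \<in> C"
    have right: "tf_colourable {z\<in>C. z \<sqsubseteq> Q \<and> (\<exists>V\<in>prongs Q. z \<frown> V \<and> r Q < r V)} (rect_ov l r b t) (w * (link_bound w * 1))"
      using cf nonest Q by (rule right_prong_tf_colourable)
    have left: "tf_colourable {z\<in>C. z \<sqsubseteq> Q \<and> (\<exists>V\<in>prongs Q. z \<frown> V \<and> l V < l Q)} (rect_ov l r b t) (w * (link_bound w * 1))"
      using clean_family.right_prong_tf_colourable[OF refl _ _ Q] cf nonest by simp
    from right left show "tf_colourable {z\<in>C. z \<sqsubseteq> Q \<and> (\<exists>V\<in>prongs Q. z \<frown> V)} (rect_ov l r b t)
        (w * (link_bound w * 1) + w * (link_bound w * 1))"
    proof (rule tf_colourable_cover)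
      have "r Q < r V \<or> l V < l Q" if "V \<in> prongs Q" for V
        using nonest[OF prongsD(1)[OF that] Q] ov_sym[OF prongsD(2)[OF that]] by (auto simp: interval_le_def)
      then show "{z\<in>C. z \<sqsubseteq> Q \<and> (\<exists>V\<in>prongs Q. z \<frown> V)} \<subseteq>
          {z\<in>C. z \<sqsubseteq> Q \<and> (\<exists>V\<in>prongs Q. z \<frown> V \<and> r Q < r V)} \<union>
          {z\<in>C. z \<sqsubseteq> Q \<and> (\<exists>V\<in>prongs Q. z \<frown> V \<and> l V < l Q)}" by blast
    qed
  qed
qed (simp add: tf_colourable_def)

text \<open>A member of \<open>D - S\<close> has a neighbour \<open>E\<close> whose x-interval
  contains its own. So by \<open>no_elbow\<close> no neighbour contains its y-interval, and the
  transposed family has no nested overlaps. \<open>E\<close> may lie in \<open>S\<close>, but it is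
  in \<open>D\<close>, where all overlapping pairs are linked.\<close>

lemma (in clean_family) tf_colourable_corner_free:
  assumes cf: "corner_free l r b t C"
  shows "tf_colourable C (rect_ov l r b t) (link_bound w * (nonest_bound w + nonest_bound w))"
proof (rule tf_colourable_classes[OF side_linked_colouring[OF cf]])
  fix D assume D: "D \<subseteq> C" and linked: "\<And>x y. x \<in> D \<Longrightarrow> y \<in> D \<Longrightarrow> \<not> (x \<frown> y \<and> \<not> side_linked l r b t C x y)"
  define S where "S = {x\<in>D. \<forall>y\<in>D. x \<frown> y \<longrightarrow> \<not> interval_le l r x y}"
  have SC: "S \<subseteq> C" "D - S \<subseteq> C" using D by (auto simp: S_def)
  have "tf_colourable S (rect_ov l r b t) (nonest_bound w)"
  proof (rule clean_family.tf_colourable_nonest)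
    show "clean_family l r b t S w" using clean_family_axioms SC(1) by (rule clean_family_subset)
    show "corner_free l r b t S" using cf SC(1) by (rule corner_free_subset)
  qed (simp add: S_def)
  moreover have "tf_colourable (D - S) (rect_ov b t l r) (nonest_bound w)"
  proof (rule clean_family.tf_colourable_nonest)
    show "clean_family b t l r (D - S) w"
      using clean_family_axioms SC(2) by (rule clean_family_transpose[OF clean_family_subset])
    show "corner_free b t l r (D - S)"
      unfolding corner_free_transpose[of b t l r] using cf SC(2) by (rule corner_free_subset)
    fix A B assume AB: "A \<in> D - S" "B \<in> D - S" "rect_ov b t l r A B"
    then have "A \<frown> B" by (simp only: rect_ov_transpose[of b t l r])
    obtain E where E: "E \<in> D" "A \<frown> E" "interval_le l r A E" using AB(1) by (auto simp: S_def)
    have C: "A \<in> C" "B \<in> C" "E \<in> C" using AB D E(1) by auto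
    have "side_linked l r b t C B E" if "B \<frown> E" using linked[of B E] that AB(2) E(1) by blast
    then show "\<not> interval_le b t A B" using no_elbow[OF cf C \<open>A \<frown> B\<close> _ E(2,3)] by blast
  qed
  ultimately show "tf_colourable D (rect_ov l r b t) (nonest_bound w + nonest_bound w)"
    unfolding rect_ov_transpose[of b t l r] by (rule tf_colourable_cover) (auto simp: S_def)
qed

definition noncross_bound :: "nat \<Rightarrow> nat" where
  "noncross_bound w = ((corner_bound w * corner_bound w) * (corner_bound w * corner_bound w)) *
    (link_bound w * (nonest_bound w + nonest_bound w))"

lemma (in clean_family) tf_colourable_clean_family: "tf_colourable C (rect_ov l r b t) (noncross_bound w)"
  unfolding noncross_bound_def
proof (rule corner_free_classes)
  fix D assume D: "D \<subseteq> C" "corner_free l r b t D"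
  have "clean_family l r b t D w" using clean_family_axioms D(1) by (rule clean_family_subset)
  then show "tf_colourable D (rect_ov l r b t) (link_bound w * (nonest_bound w + nonest_bound w))"
    using D(2) by (rule clean_family.tf_colourable_corner_free)
qed

section \<open>Crossings and perturbation\<close>

text \<open>Crossing orders rectangles by shrinking y-interval and growing x-interval, and the outer
  two of three crossing in a row cross again. So heights separate all crossings.\<close>

lemma tf_colourable_clean_crossing:
  assumes fin: "finite C" and genx: "generic l r C" and geny: "generic b t C"
    and clean: "\<And>x y z. x \<in> C \<Longrightarrow> y \<in> C \<Longrightarrow> z \<in> C \<Longrightarrow> rect_ov l r b t x y \<Longrightarrow> rect_sub l r b t z x \<Longrightarrow> rect_sub l r b t z y \<Longrightarrow> False"
    and cliques: "\<And>K. K \<subseteq> C \<Longrightarrow> (\<And>x y. x \<in> K \<Longrightarrow> y \<in> K \<Longrightarrow> x \<noteq> y \<Longrightarrow> rect_ov l r b t x y) \<Longrightarrow> card K \<le> w"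
  shows "tf_colourable C (rect_ov l r b t) (w * noncross_bound w)"
proof -
  define R where "R x y \<longleftrightarrow> rect_ov l r b t x y \<and> interval_le l r x y \<and> interval_le b t y x" for x y
  have irr: "\<not> rect_ov l r b t x x" for x by (simp add: rect_ov_def rect_sub_def interval_le_def)
  have "colourable C (\<lambda>x y. R x y \<or> R y x) w"
  proof (rule colourable_heights[OF fin])
    show "\<not> R x x" for x using irr by (simp add: R_def)
    show "card K \<le> w" if "K \<subseteq> C" "\<And>x y. x \<in> K \<Longrightarrow> y \<in> K \<Longrightarrow> x \<noteq> y \<Longrightarrow> R x y \<or> R y x" for K
      by (rule cliques) (use that in \<open>auto simp: R_def dest: ov_sym\<close>)
    fix x y z assume C: "x \<in> C" "y \<in> C" "z \<in> C" and R: "R x y" "R y z"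
    have n: "interval_le l r x z" "interval_le b t z x" using R by (auto simp: R_def interval_le_def)
    have "x \<noteq> y" using R(1) irr by (auto simp: R_def)
    then have "l x \<noteq> l y" using genD(4)[OF genx C(1,2)] by blast
    then have "l z < l x" using R by (auto simp: R_def interval_le_def)
    moreover have "x \<noteq> z" using calculation by auto
    then have "b x \<noteq> b z" using genD(4)[OF geny C(1,3)] by blast
    ultimately have "\<not> rect_sub l r b t x z" "\<not> rect_sub l r b t z x" using n by (auto simp: rect_sub_def interval_le_def)
    moreover have "interval_meets l r x z" "interval_meets b t x z"
      using n genD(1)[OF genx C(1)] genD(1)[OF geny C(3)] by (auto simp: interval_le_def interval_meets_def)
    ultimately show "R x z" using n by (simp add: R_def rect_ov_def)
  qed
  then show ?thesis
  proof (rule tf_colourable_classes)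
    fix D assume D: "D \<subseteq> C" and no: "\<And>x y. x \<in> D \<Longrightarrow> y \<in> D \<Longrightarrow> \<not> (R x y \<or> R y x)"
    show "tf_colourable D (rect_ov l r b t) (noncross_bound w)"
    proof (rule clean_family.tf_colourable_clean_family, unfold_locales)
      show "finite D" using D fin by (rule finite_subset)
      show "generic l r D" "generic b t D" using genx geny D by (simp_all add: generic_subset)
      show False if "x \<in> D" "y \<in> D" "z \<in> D" "rect_ov l r b t x y" "rect_sub l r b t z x" "rect_sub l r b t z y" for x y z
        using clean[of x y z] that D by auto
      show False if "x \<in> D" "y \<in> D" "rect_ov l r b t x y" "interval_le l r x y" "interval_le b t y x" for x y
        using no[of x y] that by (simp add: R_def)
      show "card K \<le> w" if "K \<subseteq> D" "\<And>x y. x \<in> K \<Longrightarrow> y \<in> K \<Longrightarrow> x \<noteq> y \<Longrightarrow> rect_ov l r b t x y" for K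
        using that D by (intro cliques) auto
    qed
  qed
qed

section \<open>Perturbation to general position\<close>

lemma finite_gap:
  fixes A :: "real set"
  assumes "finite A"
  obtains \<delta> where "\<delta> > 0" "\<And>a c. a \<in> A \<Longrightarrow> c \<in> A \<Longrightarrow> a < c \<Longrightarrow> \<delta> \<le> c - a"
proof -
  \<comment> \<open>The 1 keeps the minimum defined when \<open>A\<close> has no two distinct
    elements.\<close>
  define D where "D = insert 1 {d \<in> (\<lambda>(a, c). c - a) ` (A \<times> A). d > 0}"
  have D: "finite D" "D \<noteq> {}" "\<And>d. d \<in> D \<Longrightarrow> d > 0" using assms by (auto simp: D_def)
  show thesis
  proof (rule that[of "Min D"])
    show "Min D > 0" using D by simp
    fix a c assume "a \<in> A" "c \<in> A" "a < c"
    then have "c - a \<in> D" by (auto simp: D_def)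
    then show "Min D \<le> c - a" using D(1) by simp
  qed
qed

text \<open>Each interval grows by \<open>s x\<close> at both ends. Growth below the gap reverses no
  strict inequality and decides the ties: touching intervals meet properly, and equal ends are
  separated by the distinct values of \<open>s\<close>. Containment survives if the container grows
  at least as much.\<close>

lemma perturbation_1d:
  fixes l r s :: "'a \<Rightarrow> real"
  assumes lr: "\<forall>x\<in>V. l x < r x"
    and gap: "\<forall>a \<in> l ` V \<union> r ` V. \<forall>c \<in> l ` V \<union> r ` V. a < c \<longrightarrow> \<delta> \<le> c - a"
    and pos: "\<forall>x\<in>V. 0 < s x" and inj: "inj_on s V" and small: "\<forall>x\<in>V. \<forall>y\<in>V. s x + s y < \<delta>"
  defines "l' \<equiv> \<lambda>x. l x - s x" and "r' \<equiv> \<lambda>x. r x + s x"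
  shows "generic l' r' V"
    and "\<And>x y. x \<in> V \<Longrightarrow> y \<in> V \<Longrightarrow> interval_meets l' r' x y \<longleftrightarrow> interval_meets l r x y"
    and "\<And>x y. x \<in> V \<Longrightarrow> y \<in> V \<Longrightarrow> interval_le l' r' x y \<Longrightarrow> interval_le l r x y"
    and "\<And>x y. x \<in> V \<Longrightarrow> y \<in> V \<Longrightarrow> s x \<le> s y \<Longrightarrow> interval_le l r x y \<Longrightarrow> interval_le l' r' x y"
proof -
  have s: "0 < s x" "s x + s y < \<delta>" if "x \<in> V" "y \<in> V" for x y using pos small that by simp_all
  have gaps: "l x < l y \<Longrightarrow> \<delta> \<le> l y - l x" "r x < r y \<Longrightarrow> \<delta> \<le> r y - r x" "l x < r y \<Longrightarrow> \<delta> \<le> r y - l x"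
    "r x < l y \<Longrightarrow> \<delta> \<le> l y - r x" if "x \<in> V" "y \<in> V" for x y
    using gap that by auto
  show "generic l' r' V" unfolding generic_def
  proof (intro conjI ballI impI)
    fix x assume x: "x \<in> V"
    show "l' x < r' x" using bspec[OF lr x] s(1)[OF x x] unfolding l'_def r'_def by linarith
    fix y assume y: "y \<in> V"
    show "l' x \<noteq> r' y"
      using gaps(4)[OF y x] s(1)[OF x x] s(1)[OF y y] s(2)[OF x y] unfolding l'_def r'_def by linarith
    show "r' x \<noteq> l' y"
      using gaps(4)[OF x y] s(1)[OF x x] s(1)[OF y y] s(2)[OF x y] unfolding l'_def r'_def by linarith
    assume "x \<noteq> y"
    then have "s x \<noteq> s y" using inj x y by (auto dest: inj_onD)
    then show "l' x \<noteq> l' y" "r' x \<noteq> r' y"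
      using gaps(1,2)[OF x y] gaps(1,2)[OF y x] s(1)[OF x x] s(1)[OF y y] s(2)[OF x y]
      unfolding l'_def r'_def by linarith+
  qed
  fix x y assume V: "x \<in> V" "y \<in> V"
  note facts = s(1)[OF V] s(1)[OF V(2,1)] s(2)[OF V]
  show "interval_meets l' r' x y \<longleftrightarrow> interval_meets l r x y"
    using gaps(4)[OF V] gaps(4)[OF V(2,1)] facts unfolding interval_meets_def l'_def r'_def by linarith
  show "interval_le l r x y" if "interval_le l' r' x y"
    using that gaps(1,2)[OF V] gaps(1,2)[OF V(2,1)] facts unfolding interval_le_def l'_def r'_def by linarith
  show "interval_le l' r' x y" if "s x \<le> s y" "interval_le l r x y"
    using that unfolding interval_le_def l'_def r'_def by linarith
qed

text \<open>A linear extension: count the members below, and break ties by an enumeration.\<close>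

lemma containment_ranking:
  assumes fin: "finite V"
    and trans: "\<And>x y z. le x y \<Longrightarrow> le y z \<Longrightarrow> le x z"
    and antisym: "\<And>x y. x \<in> V \<Longrightarrow> y \<in> V \<Longrightarrow> le x y \<Longrightarrow> le y x \<Longrightarrow> x = y"
    and refl: "\<And>x. le x x"
  obtains s :: "'a \<Rightarrow> nat" where "inj_on s V" "\<And>x y. x \<in> V \<Longrightarrow> y \<in> V \<Longrightarrow> le x y \<Longrightarrow> s x \<le> s y"
proof -
  obtain i where i: "bij_betw i V {0..<card V}" using ex_bij_betw_finite_nat[OF fin] by blast
  have il: "i x < card V" if "x \<in> V" for x using bij_betw_apply[OF i that] by simp
  define c where "c x = card {k\<in>V. le k x}" for x
  show thesis
  proof (rule that[of "\<lambda>x. c x * card V + i x"])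
    show "inj_on (\<lambda>x. c x * card V + i x) V"
    proof (rule inj_onI)
      fix x y assume "x \<in> V" "y \<in> V" "c x * card V + i x = c y * card V + i y"
      then have "i x = i y" using pair_code_inj il by blast
      then show "x = y" using i \<open>x \<in> V\<close> \<open>y \<in> V\<close> by (auto simp: bij_betw_def dest: inj_onD)
    qed
    fix x y assume V: "x \<in> V" "y \<in> V" "le x y"
    show "c x * card V + i x \<le> c y * card V + i y"
    proof (cases "x = y")
      case False
      have "c x < c y" unfolding c_def
      proof (rule psubset_card_mono)
        have "{k\<in>V. le k x} \<subseteq> {k\<in>V. le k y}" using trans V(3) by blast
        moreover have "y \<in> {k\<in>V. le k y}" "y \<notin> {k\<in>V. le k x}" using V refl antisym[OF V(1,2,3)] False by auto
        ultimately show "{k\<in>V. le k x} \<subset> {k\<in>V. le k y}" by blast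
      qed (use fin in auto)
      then have "c x * card V + i x < c y * card V" using il[OF V(1)] by (rule pair_code_less)
      then show ?thesis by simp
    qed simp
  qed
qed

lemma perturbation:
  assumes fin: "finite V"
    and lr: "\<And>x. x \<in> V \<Longrightarrow> l x < r x" and bt: "\<And>x. x \<in> V \<Longrightarrow> b x < t x"
    and antisym: "\<And>x y. x \<in> V \<Longrightarrow> y \<in> V \<Longrightarrow> rect_sub l r b t x y \<Longrightarrow> rect_sub l r b t y x \<Longrightarrow> x = y"
  shows "\<exists>l' r' b' t'. generic l' r' V \<and> generic b' t' V \<and>
    (\<forall>x\<in>V. \<forall>y\<in>V. (rect_sub l' r' b' t' x y \<longleftrightarrow> rect_sub l r b t x y) \<and> (rect_ov l' r' b' t' x y \<longleftrightarrow> rect_ov l r b t x y))"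
proof -
  obtain s where s: "inj_on s V" "\<And>x y. x \<in> V \<Longrightarrow> y \<in> V \<Longrightarrow> rect_sub l r b t x y \<Longrightarrow> s x \<le> (s y :: nat)"
  proof (rule containment_ranking[of V "rect_sub l r b t"])
    show "rect_sub l r b t x z" if "rect_sub l r b t x y" "rect_sub l r b t y z" for x y z
      using that by (auto simp: rect_sub_def interval_le_def)
    show "rect_sub l r b t x x" for x by (simp add: rect_sub_def interval_le_def)
  qed (use fin antisym in auto)
  define A where "A = (l ` V \<union> r ` V) \<union> (b ` V \<union> t ` V)"
  have "finite A" using fin by (simp add: A_def)
  then obtain \<delta> where \<delta>: "\<delta> > 0" "\<And>a c. a \<in> A \<Longrightarrow> c \<in> A \<Longrightarrow> a < c \<Longrightarrow> \<delta> \<le> c - a"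
    by (rule finite_gap) (rule that)
  \<comment> \<open>The inserted 0 covers empty \<open>V\<close>; below, the 3 in \<open>e\<close>
    bounds every growth by a third of \<open>\<delta>\<close>, so that two together stay under the
    gap.\<close>
  define M where "M = real (Max (insert 0 (s ` V))) + 1"
  have M: "real (s x) + 1 \<le> M" if "x \<in> V" for x
    using that fin unfolding M_def by (simp add: Max_ge)
  have "M \<ge> 1" by (simp add: M_def)
  define e where "e = \<delta> / (3 * M)"
  have e: "e > 0" "3 * (M * e) = \<delta>" using \<delta>(1) \<open>M \<ge> 1\<close> by (auto simp: e_def)
  define \<sigma> where "\<sigma> x = (real (s x) + 1) * e" for x
  have pos: "0 < \<sigma> x" for x using e(1) by (simp add: \<sigma>_def add_nonneg_pos)
  have small: "\<sigma> x + \<sigma> y < \<delta>" if "x \<in> V" "y \<in> V" for x y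
  proof -
    have "\<sigma> x \<le> M * e" "\<sigma> y \<le> M * e" unfolding \<sigma>_def using M that e(1) by (simp_all add: mult_right_mono)
    then show ?thesis using e \<delta>(1) by linarith
  qed
  have inj: "inj_on \<sigma> V" using s(1) e(1) by (auto simp: inj_on_def \<sigma>_def)
  have mono: "\<sigma> x \<le> \<sigma> y" if "x \<in> V" "y \<in> V" "rect_sub l r b t x y" for x y
    using s(2)[OF that] e(1) by (simp add: \<sigma>_def)
  define l' where "l' x = l x - \<sigma> x" for x
  define r' where "r' x = r x + \<sigma> x" for x
  define b' where "b' x = b x - \<sigma> x" for x
  define t' where "t' x = t x + \<sigma> x" for x
  have "\<forall>a \<in> l ` V \<union> r ` V. \<forall>c \<in> l ` V \<union> r ` V. a < c \<longrightarrow> \<delta> \<le> c - a"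
    by (intro ballI impI \<delta>(2)) (auto simp: A_def)
  note X = perturbation_1d[of V l r \<delta> \<sigma>, OF _ this _ inj, folded l'_def r'_def]
  have "\<forall>a \<in> b ` V \<union> t ` V. \<forall>c \<in> b ` V \<union> t ` V. a < c \<longrightarrow> \<delta> \<le> c - a"
    by (intro ballI impI \<delta>(2)) (auto simp: A_def)
  note Y = perturbation_1d[of V b t \<delta> \<sigma>, OF _ this _ inj, folded b'_def t'_def]
  have prem: "\<forall>x\<in>V. l x < r x" "\<forall>x\<in>V. b x < t x" "\<forall>x\<in>V. 0 < \<sigma> x" "\<forall>x\<in>V. \<forall>y\<in>V. \<sigma> x + \<sigma> y < \<delta>"
    using lr bt pos small by simp_all
  note X = X[OF prem(1,3,4)] and Y = Y[OF prem(2,3,4)]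
  have rect_sub: "rect_sub l' r' b' t' x y \<longleftrightarrow> rect_sub l r b t x y" if "x \<in> V" "y \<in> V" for x y
    using X(3,4)[OF that] Y(3,4)[OF that] mono[OF that] by (auto simp: rect_sub_def)
  have "rect_ov l' r' b' t' x y \<longleftrightarrow> rect_ov l r b t x y" if "x \<in> V" "y \<in> V" for x y
    using X(2)[OF that] Y(2)[OF that] rect_sub[OF that] rect_sub[OF that(2,1)] by (simp add: rect_ov_def)
  then show ?thesis
    using X(1) Y(1) rect_sub by (intro exI[of _ l'] exI[of _ r'] exI[of _ b'] exI[of _ t']) simp
qed

section \<open>From sets of points to endpoint functions\<close>

lemma overlap_rectangles:
  fixes l r b t :: "'a \<Rightarrow> real"
  assumes "l x \<le> r x" "b x \<le> t x" "l y \<le> r y" "b y \<le> t y"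
  defines "R z \<equiv> {l z..r z} \<times> {b z..t z}"
  shows "R x \<subseteq> R y \<longleftrightarrow> rect_sub l r b t x y"
    and "overlap (R x) (R y) \<longleftrightarrow> rect_ov l r b t x y"
proof -
  have rect_sub: "R u \<subseteq> R v \<longleftrightarrow> rect_sub l r b t u v" if "l u \<le> r u" "b u \<le> t u" for u v
  proof
    assume "R u \<subseteq> R v"
    moreover have "(l u, b u) \<in> R u" "(r u, t u) \<in> R u" using that by (auto simp: R_def)
    ultimately have "(l u, b u) \<in> R v" "(r u, t u) \<in> R v" by blast+
    then show "rect_sub l r b t u v" by (auto simp: R_def rect_sub_def interval_le_def)
  qed (auto simp: R_def rect_sub_def interval_le_def)
  have "R x \<inter> R y \<noteq> {} \<longleftrightarrow> interval_meets l r x y \<and> interval_meets b t x y"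
  proof
    assume "interval_meets l r x y \<and> interval_meets b t x y"
    then have "(max (l x) (l y), max (b x) (b y)) \<in> R x \<inter> R y"
      using assms(1-4) by (auto simp: R_def interval_meets_def)
    then show "R x \<inter> R y \<noteq> {}" by blast
  qed (auto simp: R_def interval_meets_def)
  then show "overlap (R x) (R y) \<longleftrightarrow> rect_ov l r b t x y"
    using rect_sub[OF assms(1,2), of y] rect_sub[OF assms(3,4), of x] by (auto simp: overlap_def rect_ov_def)
  show "R x \<subseteq> R y \<longleftrightarrow> rect_sub l r b t x y" using rect_sub[OF assms(1,2)] .
qed

lemma card_le_clique_number:
  assumes "finite V" "K \<subseteq> V" "clique K E"
  shows "card K \<le> clique_number V E"
  unfolding clique_number_def
proof (rule Max_ge)
  have "{card K |K. K \<subseteq> V \<and> clique K E} \<subseteq> card ` Pow V" by auto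
  then show "finite {card K |K. K \<subseteq> V \<and> clique K E}" using assms(1) finite_subset by blast
qed (use assms in blast)

lemma clique_free_chromatic_number_le_tf_colourable:
  assumes "tf_colourable V (\<lambda>x y. {x, y} \<in> E) n"
  shows "clique_free_chromatic_number 3 V E \<le> n"
  using assms
proof (rule tf_colourableE)
  fix f assume f: "\<And>x. x \<in> V \<Longrightarrow> f x < n"
    "\<And>x y z. x \<in> V \<Longrightarrow> y \<in> V \<Longrightarrow> z \<in> V \<Longrightarrow> {x, y} \<in> E \<Longrightarrow> {y, z} \<in> E \<Longrightarrow> {x, z} \<in> E \<Longrightarrow> f x = f y \<Longrightarrow> f y = f z \<Longrightarrow> False"
  have "False" if K: "K \<in> [{v\<in>V. f v = i}]\<^bsup>3\<^esup>" "clique K E" for K i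
  proof -
    have "card K = 3" "K \<subseteq> {v\<in>V. f v = i}" using K(1) by (auto simp: nsets_def)
    moreover obtain x y z where "K = {x, y, z}" "x \<noteq> y" "y \<noteq> z" "x \<noteq> z"
      using \<open>card K = 3\<close> by (auto simp: card_3_iff)
    ultimately show False using f(2)[of x y z] K(2) by (simp add: clique_def)
  qed
  then have "clique_free_coloring 3 V E n f"
    using f(1) unfolding clique_free_coloring_def by blast
  then show ?thesis unfolding clique_free_chromatic_number_def by (intro Least_le) blast
qed

lemma clean_rectangle_overlap_graph_tf_colourable:
  assumes "clean_rectangle_overlap_graph V E"
  shows "tf_colourable V (\<lambda>x y. {x, y} \<in> E) (clique_number V E * noncross_bound (clique_number V E))"
proof -
  obtain \<mu> where fin: "finite V" and rep: "rectangle_overlap_representation V E \<mu>"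
    and cl: "clean_representation V \<mu>"
    using assms unfolding clean_rectangle_overlap_graph_def simple_graph_def by blast
  note rep' = rep[unfolded rectangle_overlap_representation_def]
  obtain R where R: "R \<subseteq> rectangles" "bij_betw \<mu> V R"
    using conjunct1[OF rep'] by (elim exE conjE) (rule that)
  have edge: "{u, v} \<in> E \<longleftrightarrow> overlap (\<mu> u) (\<mu> v)" if "u \<in> V" "v \<in> V" for u v
    using conjunct2[OF rep'] that by simp
  have "\<forall>u\<in>V. \<exists>q. \<mu> u = {fst (fst q)..snd (fst q)} \<times> {fst (snd q)..snd (snd q)} \<and>
      fst (fst q) < snd (fst q) \<and> fst (snd q) < snd (snd q)"
  proof
    fix u assume "u \<in> V"
    then have "\<mu> u \<in> rectangles" using subsetD[OF R(1)] bij_betw_apply[OF R(2)] by simp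
    then obtain a c d e where "\<mu> u = {a..c} \<times> {d..e}" "a < c" "d < e" unfolding rectangles_def by blast
    then show "\<exists>q. \<mu> u = {fst (fst q)..snd (fst q)} \<times> {fst (snd q)..snd (snd q)} \<and>
      fst (fst q) < snd (fst q) \<and> fst (snd q) < snd (snd q)"
      by (intro exI[of _ "((a, c), (d, e))"]) simp
  qed
  from bchoice[OF this] obtain q where q: "\<forall>u\<in>V. \<mu> u = {fst (fst (q u))..snd (fst (q u))} \<times>
      {fst (snd (q u))..snd (snd (q u))} \<and> fst (fst (q u)) < snd (fst (q u)) \<and> fst (snd (q u)) < snd (snd (q u))"
    by (elim exE) (rule that)
  define l where "l u = fst (fst (q u))" for u
  define r where "r u = snd (fst (q u))" for u
  define b where "b u = fst (snd (q u))" for u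
  define t where "t u = snd (snd (q u))" for u
  have \<mu>: "\<mu> u = {l u..r u} \<times> {b u..t u}" and lr: "l u < r u" and bt: "b u < t u" if "u \<in> V" for u
    using q that by (simp_all add: l_def r_def b_def t_def)
  have rect_sub: "\<mu> x \<subseteq> \<mu> y \<longleftrightarrow> rect_sub l r b t x y" and rect_ov: "overlap (\<mu> x) (\<mu> y) \<longleftrightarrow> rect_ov l r b t x y"
    if "x \<in> V" "y \<in> V" for x y
    using overlap_rectangles[of l x r b t y] lr[OF that(1)] lr[OF that(2)] bt[OF that(1)] bt[OF that(2)]
      \<mu>[OF that(1)] \<mu>[OF that(2)] by simp_all
  \<comment> \<open>Distinct vertices have distinct rectangles; this antisymmetry of containment is
    what allows the strict ranking in the perturbation.\<close>
  have "inj_on \<mu> V" using R(2) by (simp add: bij_betw_def)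
  then have antisym: "x = y" if "x \<in> V" "y \<in> V" "rect_sub l r b t x y" "rect_sub l r b t y x" for x y
    using rect_sub[OF that(1,2)] rect_sub[OF that(2,1)] that by (auto dest: inj_onD)
  have "\<exists>l' r' b' t'. generic l' r' V \<and> generic b' t' V \<and>
    (\<forall>x\<in>V. \<forall>y\<in>V. (rect_sub l' r' b' t' x y \<longleftrightarrow> rect_sub l r b t x y) \<and> (rect_ov l' r' b' t' x y \<longleftrightarrow> rect_ov l r b t x y))"
    using fin lr bt antisym by (rule perturbation)
  then obtain l' r' b' t' where generic: "generic l' r' V" "generic b' t' V" and same: "\<forall>x\<in>V. \<forall>y\<in>V.
      (rect_sub l' r' b' t' x y \<longleftrightarrow> rect_sub l r b t x y) \<and> (rect_ov l' r' b' t' x y \<longleftrightarrow> rect_ov l r b t x y)"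
    by (elim exE conjE) (rule that)
  have rect_sub': "rect_sub l' r' b' t' x y \<longleftrightarrow> rect_sub l r b t x y" and rect_ov': "rect_ov l' r' b' t' x y \<longleftrightarrow> rect_ov l r b t x y"
    if "x \<in> V" "y \<in> V" for x y
    using same that by simp_all
  have edge': "{x, y} \<in> E \<longleftrightarrow> rect_ov l' r' b' t' x y" if "x \<in> V" "y \<in> V" for x y
    using edge rect_ov rect_ov' that by simp
  have "tf_colourable V (rect_ov l' r' b' t') (clique_number V E * noncross_bound (clique_number V E))"
  proof (rule tf_colourable_clean_crossing[OF fin generic])
    fix x y z assume V: "x \<in> V" "y \<in> V" "z \<in> V"
      and "rect_ov l' r' b' t' x y" "rect_sub l' r' b' t' z x" "rect_sub l' r' b' t' z y"
    then have "overlap (\<mu> x) (\<mu> y)" "\<mu> z \<subseteq> \<mu> x \<inter> \<mu> y" using rect_ov rect_ov' rect_sub rect_sub' by simp_all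
    then show False using cl V unfolding clean_representation_def by blast
  next
    fix K assume K: "K \<subseteq> V" "\<And>x y. x \<in> K \<Longrightarrow> y \<in> K \<Longrightarrow> x \<noteq> y \<Longrightarrow> rect_ov l' r' b' t' x y"
    then have "clique K E" using edge' by (auto simp: clique_def subset_iff)
    then show "card K \<le> clique_number V E" using fin K(1) by (intro card_le_clique_number)
  qed
  then show ?thesis by (rule tf_colourable_mono) (use edge' in auto)
qed

theorem theorem1p4:
  shows "\<exists>f :: nat \<Rightarrow> nat. \<forall>(V :: 'a set) (E :: 'a set set).
    clean_rectangle_overlap_graph V E \<longrightarrow>
    clique_free_chromatic_number 3 V E \<le> f (clique_number V E)"
  using clique_free_chromatic_number_le_tf_colourable[OF clean_rectangle_overlap_graph_tf_colourable]
  by (intro exI[of _ "\<lambda>w. w * noncross_bound w"]) blast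

end
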